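(* Let $f \colon \widehat{\mathbb{C}} \rightarrow \widehat{\mathbb{C}}$ be a quadratic rational map (that is, a rational map of degree $2$) that has only integer multipliers, i.e. the multiplier of $f$ at each of its cycles lies in $\mathbb{Z}$. Then $f$ is either a power map or a Chebyshev map.
   Context: $\widehat{\mathbb{C}} = \mathbb{C} \cup \lbrace \infty \rbrace$ is the Riemann sphere, and $f^{\circ n}$ is the $n$th iterate of $f$. A point $z_{0} \in \widehat{\mathbb{C}}$ is periodic for a rational map $f$ if $f^{\circ n}(z_{0}) = z_{0}$ for some $n \geq 1$; the least such $n$ is its period, and its forward orbit $\lbrace f^{\circ k}(z_{0}) : k \geq 0 \rbrace$, of cardinality $n$, is called a cycle (with period $n$). The multiplier of $f$ at $z_{0}$ is the unique eigenvalue of the differential of $f^{\circ n}$ at $z_{0}$ (as a linear endomorphism of the complex tangent line at $z_{0}$); it is the same at every point of the cycle and is called the multiplier of $f$ at the cycle. Two rational maps $f, g$ are conjugate if there is a M\"{o}bius transformation $\phi$ with $\phi \circ f = g \circ \phi$. A rational map of degree $d \geq 2$ is a power map if it is conjugate to $z \mapsto z^{d}$ or to $z \mapsto z^{-d}$. For $d \geq 2$, the Chebyshev polynomial $T_{d} \in \mathbb{C}[z]$ is the unique polynomial such that $T_{d}(z + z^{-1}) = z^{d} + z^{-d}$; a rational map of degree $d \geq 2$ is a Chebyshev map if it is conjugate to $T_{d}$ or to $-T_{d}$. *)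

theory Defs
  imports
    "HOL-Analysis.Analysis"
    "HOL-Computational_Algebra.Polynomial"
begin

section \<open>The Riemann sphere and rational maps\<close>

datatype riemann_sphere = Fin complex | Infty

text \<open>
  The self-map of the sphere induced by the quotient \<open>p / q\<close>. It is only meaningful for coprime
  \<open>p\<close> and \<open>q\<close>, so that the numerator does not vanish where the denominator does; the value at
  infinity is the limit of \<open>p z / q z\<close>, read off from the coefficients of degree
  \<open>max (degree p) (degree q)\<close>.
\<close>
definition rat_fun :: "complex poly \<Rightarrow> complex poly \<Rightarrow> riemann_sphere \<Rightarrow> riemann_sphere" where
  "rat_fun p q x = (case x of
      Fin z \<Rightarrow> (if poly q z = 0 then Infty else Fin (poly p z / poly q z))
    | Infty \<Rightarrow>
        (let m = max (degree p) (degree q)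
         in if coeff q m = 0 then Infty else Fin (coeff p m / coeff q m)))"

definition rational_map_of_degree :: "nat \<Rightarrow> (riemann_sphere \<Rightarrow> riemann_sphere) \<Rightarrow> bool" where
  "rational_map_of_degree d f \<longleftrightarrow>
     (\<exists>p q. coprime p q \<and> max (degree p) (degree q) = d \<and> f = rat_fun p q)"

definition moebius_transformation :: "(riemann_sphere \<Rightarrow> riemann_sphere) \<Rightarrow> bool" where
  "moebius_transformation \<phi> \<longleftrightarrow>
     (\<exists>a b c d. a * d - b * c \<noteq> 0 \<and> \<phi> = rat_fun [:b, a:] [:d, c:])"

definition conjugate_maps ::
    "(riemann_sphere \<Rightarrow> riemann_sphere) \<Rightarrow> (riemann_sphere \<Rightarrow> riemann_sphere) \<Rightarrow> bool" where
  "conjugate_maps f g \<longleftrightarrow> (\<exists>\<phi>. moebius_transformation \<phi> \<and> \<phi> \<circ> f = g \<circ> \<phi>)"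


section \<open>Cycles and multipliers\<close>

definition periodic_point :: "('a \<Rightarrow> 'a) \<Rightarrow> 'a \<Rightarrow> bool" where
  "periodic_point f x \<longleftrightarrow> (\<exists>n\<ge>1. (f ^^ n) x = x)"

definition period :: "('a \<Rightarrow> 'a) \<Rightarrow> 'a \<Rightarrow> nat" where
  "period f x = (LEAST n. n \<ge> 1 \<and> (f ^^ n) x = x)"

definition forward_orbit :: "('a \<Rightarrow> 'a) \<Rightarrow> 'a \<Rightarrow> 'a set" where
  "forward_orbit f x = {(f ^^ k) x | k. True}"

definition cycles :: "('a \<Rightarrow> 'a) \<Rightarrow> 'a set set" where
  "cycles f = {forward_orbit f x | x. periodic_point f x}"

text \<open>
  A holomorphic coordinate around the point \<open>x\<close> and its inverse: the identity if \<open>x\<close> is finite,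
  and \<open>z \<mapsto> 1 / z\<close> (with \<open>Infty \<mapsto> 0\<close>) if \<open>x\<close> is infinite. The coordinate takes the dummy value
  \<open>0\<close> at the one point outside its domain.
\<close>
definition coord :: "riemann_sphere \<Rightarrow> riemann_sphere \<Rightarrow> complex" where
  "coord x y = (case x of
      Fin _ \<Rightarrow> (case y of Fin z \<Rightarrow> z | Infty \<Rightarrow> 0)
    | Infty \<Rightarrow> (case y of Fin z \<Rightarrow> 1 / z | Infty \<Rightarrow> 0))"

definition coord_inv :: "riemann_sphere \<Rightarrow> complex \<Rightarrow> riemann_sphere" where
  "coord_inv x w = (case x of
      Fin _ \<Rightarrow> Fin w
    | Infty \<Rightarrow> (if w = 0 then Infty else Fin (1 / w)))"

text \<open>
  In the coordinate around \<open>x\<close>, the differential at a fixed point \<open>x\<close> of \<open>g\<close> is multiplication by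
  the following complex derivative, which is therefore its unique eigenvalue.
\<close>
definition differential_eigenvalue ::
    "(riemann_sphere \<Rightarrow> riemann_sphere) \<Rightarrow> riemann_sphere \<Rightarrow> complex" where
  "differential_eigenvalue g x = deriv (\<lambda>w. coord x (g (coord_inv x w))) (coord x x)"

definition multiplier :: "(riemann_sphere \<Rightarrow> riemann_sphere) \<Rightarrow> riemann_sphere \<Rightarrow> complex" where
  "multiplier f x = differential_eigenvalue (f ^^ period f x) x"

text \<open>
  The multiplier at a cycle is the multiplier at any of its points.
\<close>
definition only_integer_multipliers :: "(riemann_sphere \<Rightarrow> riemann_sphere) \<Rightarrow> bool" where
  "only_integer_multipliers f \<longleftrightarrow> (\<forall>C\<in>cycles f. \<forall>x\<in>C. multiplier f x \<in> \<int>)"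


section \<open>Power maps and Chebyshev maps\<close>

definition power_map :: "(riemann_sphere \<Rightarrow> riemann_sphere) \<Rightarrow> bool" where
  "power_map f \<longleftrightarrow>
     (\<exists>d\<ge>2. rational_map_of_degree d f \<and>
        (conjugate_maps f (rat_fun (monom 1 d) 1) \<or> conjugate_maps f (rat_fun 1 (monom 1 d))))"

definition chebyshev_poly :: "nat \<Rightarrow> complex poly" where
  "chebyshev_poly d =
     (THE T. \<forall>z. z \<noteq> 0 \<longrightarrow> poly T (z + inverse z) = z ^ d + inverse z ^ d)"

definition chebyshev_map :: "(riemann_sphere \<Rightarrow> riemann_sphere) \<Rightarrow> bool" where
  "chebyshev_map f \<longleftrightarrow>
     (\<exists>d\<ge>2. rational_map_of_degree d f \<and>
        (conjugate_maps f (rat_fun (chebyshev_poly d) 1) \<or>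
         conjugate_maps f (rat_fun (- chebyshev_poly d) 1)))"

text \<open>The description in \<^term>\<open>chebyshev_poly\<close> is well defined.\<close>

lemma chebyshev_poly_exists:
  "\<exists>T :: complex poly. \<forall>z. z \<noteq> 0 \<longrightarrow> poly T (z + inverse z) = z ^ d + inverse z ^ d"
proof (induction d rule: induct_nat_012)
  case 0
  show ?case by (rule exI[of _ "[:2:]"]) simp
next
  case 1
  show ?case by (rule exI[of _ "[:0, 1:]"]) simp
next
  case (ge2 n)
  then obtain S T :: "complex poly"
    where S: "\<And>z. z \<noteq> 0 \<Longrightarrow> poly S (z + inverse z) = z ^ n + inverse z ^ n"
      and T: "\<And>z. z \<noteq> 0 \<Longrightarrow> poly T (z + inverse z) = z ^ Suc n + inverse z ^ Suc n"
    by blast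
  show ?case
  proof (intro exI[of _ "[:0, 1:] * T - S"] allI impI)
    fix z :: complex
    assume z: "z \<noteq> 0"
    then have *: "z * inverse z = 1" by simp
    have "(z + w) * (z ^ Suc n + w ^ Suc n) - (z ^ n + w ^ n)
            = z ^ Suc (Suc n) + w ^ Suc (Suc n)" if "z * w = 1" for w
    proof -
      have "(z + w) * (z ^ Suc n + w ^ Suc n)
              = z ^ Suc (Suc n) + w ^ Suc (Suc n) + z * w * (z ^ n + w ^ n)"
        by (simp add: algebra_simps)
      then show ?thesis using that by simp
    qed
    from this[OF *]
    show "poly ([:0, 1:] * T - S) (z + inverse z)
            = z ^ Suc (Suc n) + inverse z ^ Suc (Suc n)"
      by (simp add: S[OF z] T[OF z])
  qed
qed

lemma ex_add_inverse:
  fixes w :: complex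
  shows "\<exists>z. z \<noteq> 0 \<and> z + inverse z = w"
proof -
  define s where "s = csqrt (w\<^sup>2 - 4)"
  define z where "z = (w + s) / 2"
  have "s\<^sup>2 = w\<^sup>2 - 4" by (simp add: s_def)
  then have *: "z * (w - z) = 1"
    by (simp add: z_def field_simps power2_eq_square)
  then have "z \<noteq> 0" by auto
  moreover have "inverse z = w - z" using * by (rule inverse_unique)
  ultimately show ?thesis by (intro exI[of _ z]) simp
qed

lemma chebyshev_poly_ex1:
  "\<exists>!T :: complex poly. \<forall>z. z \<noteq> 0 \<longrightarrow> poly T (z + inverse z) = z ^ d + inverse z ^ d"
proof (rule ex_ex1I[OF chebyshev_poly_exists])
  fix S T :: "complex poly"
  assume "\<forall>z. z \<noteq> 0 \<longrightarrow> poly S (z + inverse z) = z ^ d + inverse z ^ d"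
    and "\<forall>z. z \<noteq> 0 \<longrightarrow> poly T (z + inverse z) = z ^ d + inverse z ^ d"
  then have "poly S w = poly T w" for w
    using ex_add_inverse[of w] by metis
  then show "S = T" by (simp add: poly_eq_poly_eq_iff[symmetric] fun_eq_iff)
qed

lemma poly_chebyshev_poly:
  "z \<noteq> 0 \<Longrightarrow> poly (chebyshev_poly d) (z + inverse z) = z ^ d + inverse z ^ d"
  using theI'[OF chebyshev_poly_ex1[of d]] unfolding chebyshev_poly_def by blast

end

theory Submission
  imports Defs
    "HOL-Computational_Algebra.Fundamental_Theorem_Algebra"
    "HOL-Number_Theory.Cong"
begin

text \<open>
  Why integer multipliers leave so few quadratic maps. Multipliers are invariant under conjugacy, so a
  quadratic map may be replaced by a normal form adapted to a chosen fixed point: \<open>z\<^sup>2 + c\<close> if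
  its multiplier vanishes, and \<open>a * z + b + 1 / z\<close> with the fixed point at infinity if its multiplier is
  \<open>1 / a\<close> (\<open>normal_form\<close>). The multipliers of cycles of small period are then algebraic functions of one
  or two parameters, and integrality becomes a Diophantine condition.

  The fixed points restrict the parameters first. If no multiplier of a fixed point is \<open>1\<close>, the numbers
  \<open>1 - \<nu>\<close> for the three fixed points are integers whose reciprocals add up to \<open>1\<close>. Hence one of the
  multipliers is \<open>0\<close> or \<open>- 1\<close>, or all three are \<open>- 2\<close>; in the last case the map is conjugate to
  \<open>z \<mapsto> 1 / z\<^sup>2\<close> (\<open>exceptional_if_integral\<close>). So there remain fixed points of multiplier \<open>0\<close>, \<open>1\<close> and
  \<open>- 1\<close>.

  For \<open>z\<^sup>2 + c\<close> the multipliers of the two 3-cycles are the roots of a quadratic polynomial. They are integers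
  only if a certain expression in the fixed point multiplier is a perfect square, which happens
  only for \<open>c = 0\<close> and for the Chebyshev polynomial \<open>z\<^sup>2 - 2\<close> (\<open>quad_poly_integral\<close>). For
  \<open>z + b + 1 / z\<close>, where infinity is a multiple fixed point, \<open>n = b\<^sup>2\<close> is an integer and the 3-cycles
  leave \<open>n \<in> {- 1, 0, 3, 4}\<close>. These values are excluded by 4-cycles: for \<open>n = - 1\<close> and \<open>n = 3\<close> their
  multipliers are roots of a cubic polynomial without integer roots, for \<open>n = 4\<close> two of them are
  \<open>- 40 \<plusminus> 3 * \<surd>41\<close>, and the case \<open>n = 0\<close> is reduced to \<open>n = 4\<close> by the semiconjugacy \<open>z \<mapsto> z\<^sup>2\<close>
  (\<open>parabolic_not_integral\<close>). For \<open>- z + b + 1 / z\<close> the other two fixed points leave only \<open>b\<^sup>2 \<in> {0, 1}\<close>,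
  unless one of the previous cases applies, and both values are excluded in the same way
  (\<open>exceptional_if_fixed_minus_1\<close>).

  The cycles are never found by solving polynomials of high degree. A 3-cycle is described by the sum of its
  points, and a 4-cycle by the two pairs of opposite points (\<open>mixed_form_4_cycle\<close>); what remains are
  quadratic and cubic equations and polynomial identities modulo them.
\<close>

section \<open>Homogeneous coordinates on the sphere\<close>

definition sph :: "complex \<Rightarrow> complex \<Rightarrow> riemann_sphere" where
  "sph u v = (if v = 0 then Infty else Fin (u / v))"

lemma sph_eq_iff:
  assumes "u \<noteq> 0 \<or> v \<noteq> 0" "u' \<noteq> 0 \<or> v' \<noteq> 0"
  shows "sph u v = sph u' v' \<longleftrightarrow> u * v' = u' * v"
  using assms by (auto simp: sph_def field_simps)

lemma sph_cases:
  obtains u v where "u \<noteq> 0 \<or> v \<noteq> 0" "x = sph u v"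
proof (cases x)
  case (Fin z)
  then show ?thesis using that[of z 1] by (simp add: sph_def)
next
  case Infty
  then show ?thesis using that[of 1 0] by (simp add: sph_def)
qed

text \<open>
  Working with a pair \<open>(P, Q)\<close> in homogeneous coordinates removes the case distinctions at
  infinity and at poles, and by \<open>lifts_eqI\<close> it turns an equation between maps of the
  sphere into the polynomial identity \<open>P * S = R * Q\<close>.
\<close>
definition lifts ::
    "(riemann_sphere \<Rightarrow> riemann_sphere) \<Rightarrow> (complex \<Rightarrow> complex \<Rightarrow> complex) \<Rightarrow>
     (complex \<Rightarrow> complex \<Rightarrow> complex) \<Rightarrow> bool" where
  "lifts g P Q \<longleftrightarrow> (\<forall>u v. u \<noteq> 0 \<or> v \<noteq> 0 \<longrightarrow>
     (P u v \<noteq> 0 \<or> Q u v \<noteq> 0) \<and> g (sph u v) = sph (P u v) (Q u v))"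

lemma liftsI:
  assumes "\<And>u v. u \<noteq> 0 \<or> v \<noteq> 0 \<Longrightarrow> P u v \<noteq> 0 \<or> Q u v \<noteq> 0"
    and "\<And>u v. u \<noteq> 0 \<or> v \<noteq> 0 \<Longrightarrow> g (sph u v) = sph (P u v) (Q u v)"
  shows "lifts g P Q"
  using assms unfolding lifts_def by blast

lemma liftsD:
  assumes "lifts g P Q" "u \<noteq> 0 \<or> v \<noteq> 0"
  shows "P u v \<noteq> 0 \<or> Q u v \<noteq> 0" "g (sph u v) = sph (P u v) (Q u v)"
  using assms unfolding lifts_def by blast+

lemma lifts_comp:
  assumes "lifts g P Q" "lifts h R S"
  shows "lifts (h \<circ> g) (\<lambda>u v. R (P u v) (Q u v)) (\<lambda>u v. S (P u v) (Q u v))"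
  using assms unfolding lifts_def by simp

lemma lifts_eqI:
  assumes "lifts g P Q" "lifts h R S" "\<And>u v. P u v * S u v = R u v * Q u v"
  shows "g = h"
proof
  fix x
  obtain u v where uv: "u \<noteq> 0 \<or> v \<noteq> 0" "x = sph u v" by (rule sph_cases)
  show "g x = h x"
    using liftsD[OF assms(1) uv(1)] liftsD[OF assms(2) uv(1)] assms(3)[of u v]
    by (simp add: uv(2) sph_eq_iff)
qed

lemma lifts_rat_fun_linear:
  assumes "a * d - b * c \<noteq> 0"
  shows "lifts (rat_fun [:b, a:] [:d, c:]) (\<lambda>u v. a * u + b * v) (\<lambda>u v. c * u + d * v)"
proof (rule liftsI)
  fix u v :: complex
  assume uv: "u \<noteq> 0 \<or> v \<noteq> 0"
  show nz: "a * u + b * v \<noteq> 0 \<or> c * u + d * v \<noteq> 0"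
  proof (rule ccontr)
    assume "\<not> ?thesis"
    then have e: "a * u + b * v = 0" "c * u + d * v = 0" by auto
    have "(a * d - b * c) * u = 0" "(a * d - b * c) * v = 0" using e by algebra+
    then show False using assms uv by simp
  qed
  show "rat_fun [:b, a:] [:d, c:] (sph u v) = sph (a * u + b * v) (c * u + d * v)"
  proof (cases "v = 0")
    case True
    then have "u \<noteq> 0" using uv by simp
    moreover have "a \<noteq> 0 \<or> c \<noteq> 0" using assms by auto
    ultimately show ?thesis using True
      by (auto simp: sph_def rat_fun_def)
  next
    case False
    have "d + u / v * c = (c * u + d * v) / v" "b + u / v * a = (a * u + b * v) / v"
      using False by (simp_all add: field_simps)
    then show ?thesis using False by (simp add: sph_def rat_fun_def)
  qed
qed

lemma moebius_lift:
  assumes "moebius_transformation \<phi>"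
  obtains a b c d where "a * d - b * c \<noteq> 0"
    "lifts \<phi> (\<lambda>u v. a * u + b * v) (\<lambda>u v. c * u + d * v)"
  using assms lifts_rat_fun_linear unfolding moebius_transformation_def by blast

lemma moebius_of_lift:
  assumes "a * d - b * c \<noteq> 0" "lifts \<phi> (\<lambda>u v. a * u + b * v) (\<lambda>u v. c * u + d * v)"
  shows "moebius_transformation \<phi>"
  using lifts_eqI[OF assms(2) lifts_rat_fun_linear[OF assms(1)]] assms(1)
  unfolding moebius_transformation_def by blast

lemma moebius_comp:
  assumes "moebius_transformation \<phi>" "moebius_transformation \<psi>"
  shows "moebius_transformation (\<psi> \<circ> \<phi>)"
proof -
  obtain a b c d where 1: "a * d - b * c \<noteq> 0"
      "lifts \<phi> (\<lambda>u v. a * u + b * v) (\<lambda>u v. c * u + d * v)"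
    using moebius_lift[OF assms(1)] .
  obtain a' b' c' d' where 2: "a' * d' - b' * c' \<noteq> 0"
      "lifts \<psi> (\<lambda>u v. a' * u + b' * v) (\<lambda>u v. c' * u + d' * v)"
    using moebius_lift[OF assms(2)] .
  have "(a' * a + b' * c) * (c' * b + d' * d) - (a' * b + b' * d) * (c' * a + d' * c)
      = (a * d - b * c) * (a' * d' - b' * c')"
    by (simp add: algebra_simps)
  then have det: "(a' * a + b' * c) * (c' * b + d' * d) - (a' * b + b' * d) * (c' * a + d' * c) \<noteq> 0"
    using 1 2 by simp
  have "lifts (\<psi> \<circ> \<phi>) (\<lambda>u v. (a' * a + b' * c) * u + (a' * b + b' * d) * v)
      (\<lambda>u v. (c' * a + d' * c) * u + (c' * b + d' * d) * v)"
    using lifts_comp[OF 1(2) 2(2)] by (simp add: algebra_simps)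
  from moebius_of_lift[OF det this] show ?thesis .
qed

lemma moebius_inverse:
  assumes "moebius_transformation \<phi>"
  obtains \<psi> where "moebius_transformation \<psi>" "\<phi> \<circ> \<psi> = id" "\<psi> \<circ> \<phi> = id"
proof -
  obtain a b c d where 1: "a * d - b * c \<noteq> 0"
      "lifts \<phi> (\<lambda>u v. a * u + b * v) (\<lambda>u v. c * u + d * v)"
    using moebius_lift[OF assms] .
  have det: "d * a - (- b) * (- c) \<noteq> 0" using 1(1) by (simp add: algebra_simps)
  define \<psi> where "\<psi> = rat_fun [:- b, d:] [:a, - c:]"
  have 2: "lifts \<psi> (\<lambda>u v. d * u + (- b) * v) (\<lambda>u v. (- c) * u + a * v)"
    unfolding \<psi>_def by (rule lifts_rat_fun_linear[OF det])
  have id: "lifts id (\<lambda>u v. u) (\<lambda>u v. v)" by (auto simp: lifts_def)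
  have "\<phi> \<circ> \<psi> = id" "\<psi> \<circ> \<phi> = id"
    by (rule lifts_eqI[OF lifts_comp[OF 2 1(2)] id], simp add: algebra_simps)
      (rule lifts_eqI[OF lifts_comp[OF 1(2) 2] id], simp add: algebra_simps)
  moreover have "moebius_transformation \<psi>" by (rule moebius_of_lift[OF det 2])
  ultimately show ?thesis using that by blast
qed

lemma conjugate_maps_trans:
  assumes "conjugate_maps f g" "conjugate_maps g h"
  shows "conjugate_maps f h"
proof -
  obtain \<phi> \<psi> where "moebius_transformation \<phi>" "\<phi> \<circ> f = g \<circ> \<phi>"
      "moebius_transformation \<psi>" "\<psi> \<circ> g = h \<circ> \<psi>"
    using assms unfolding conjugate_maps_def by blast
  then show ?thesis unfolding conjugate_maps_def
    by (intro exI[of _ "\<psi> \<circ> \<phi>"]) (metis moebius_comp comp_assoc)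
qed

section \<open>Derivatives in the standard charts\<close>

lemma coord_inv_coord_self [simp]: "coord_inv x (coord x x) = x"
  by (cases x) (auto simp: coord_def coord_inv_def)

text \<open>
  The second conjunct says that \<open>g\<close> maps a neighbourhood of \<open>x\<close> into the domain of the chart at
  \<open>g x\<close>. Without it the dummy value of \<^const>\<open>coord\<close> could fake a derivative, and the chain
  rule would fail.
\<close>
definition has_sphere_deriv ::
    "(riemann_sphere \<Rightarrow> riemann_sphere) \<Rightarrow> riemann_sphere \<Rightarrow> complex \<Rightarrow> bool" where
  "has_sphere_deriv g x D \<longleftrightarrow>
     ((\<lambda>w. coord (g x) (g (coord_inv x w))) has_field_derivative D) (at (coord x x)) \<and>
     (\<forall>\<^sub>F w in nhds (coord x x).
        coord_inv (g x) (coord (g x) (g (coord_inv x w))) = g (coord_inv x w))"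

lemma has_sphere_deriv_unique:
  "has_sphere_deriv g x D \<Longrightarrow> has_sphere_deriv g x E \<Longrightarrow> D = E"
  unfolding has_sphere_deriv_def using DERIV_unique by blast

lemma isCont_tendsto_nhds: "isCont f x \<Longrightarrow> (f \<longlongrightarrow> f x) (nhds x)"
  unfolding isCont_def by (rule tendsto_at_iff_tendsto_nhds[THEN iffD1])

lemma DERIV_eventually_eq:
  assumes "(f has_field_derivative D) (at x)" "\<forall>\<^sub>F w in nhds x. f w = g w"
  shows "(g has_field_derivative D) (at x)"
  using DERIV_cong_ev[OF refl assms(2) refl] assms(1) by simp

lemma has_sphere_deriv_comp:
  assumes "has_sphere_deriv f x D" "has_sphere_deriv g (f x) E"
  shows "has_sphere_deriv (g \<circ> f) x (E * D)"
proof -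
  define y z where "y = f x" and "z = g y"
  define F G where "F = (\<lambda>w. coord y (f (coord_inv x w)))"
    and "G = (\<lambda>w. coord z (g (coord_inv y w)))"
  have F: "(F has_field_derivative D) (at (coord x x))"
    and evF: "\<forall>\<^sub>F w in nhds (coord x x). coord_inv y (F w) = f (coord_inv x w)"
    using assms(1) by (simp_all add: has_sphere_deriv_def F_def y_def)
  have G: "(G has_field_derivative E) (at (coord y y))"
    and evG: "\<forall>\<^sub>F w in nhds (coord y y). coord_inv z (G w) = g (coord_inv y w)"
    using assms(2) by (simp_all add: has_sphere_deriv_def G_def y_def z_def)
  have Fx: "F (coord x x) = coord y y" by (simp add: F_def y_def)
  have "(G \<circ> F has_field_derivative E * D) (at (coord x x))"
    by (rule DERIV_chain) (use F G Fx in auto)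
  moreover have "\<forall>\<^sub>F w in nhds (coord x x). (G \<circ> F) w = coord z (g (f (coord_inv x w)))"
    using evF by eventually_elim (simp add: G_def)
  ultimately have 1: "((\<lambda>w. coord z (g (f (coord_inv x w)))) has_field_derivative E * D)
      (at (coord x x))"
    by (rule DERIV_eventually_eq)
  have "isCont F (coord x x)" using F by (rule DERIV_isCont)
  then have "filterlim F (nhds (coord y y)) (nhds (coord x x))"
    unfolding Fx[symmetric] by (rule isCont_tendsto_nhds)
  then have "\<forall>\<^sub>F w in nhds (coord x x). coord_inv z (G (F w)) = g (coord_inv y (F w))"
    using evG by (rule eventually_compose_filterlim[rotated])
  then have "\<forall>\<^sub>F w in nhds (coord x x).
      coord_inv z (coord z (g (f (coord_inv x w)))) = g (f (coord_inv x w))"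
    using evF by eventually_elim (simp add: G_def)
  with 1 show ?thesis by (simp add: has_sphere_deriv_def y_def z_def)
qed

definition chart_num :: "riemann_sphere \<Rightarrow> complex \<Rightarrow> complex" where
  "chart_num x w = (case x of Fin _ \<Rightarrow> w | Infty \<Rightarrow> 1)"

definition chart_den :: "riemann_sphere \<Rightarrow> complex \<Rightarrow> complex" where
  "chart_den x w = (case x of Fin _ \<Rightarrow> 1 | Infty \<Rightarrow> w)"

lemma chart_nonzero: "chart_num x w \<noteq> 0 \<or> chart_den x w \<noteq> 0"
  by (cases x) (auto simp: chart_num_def chart_den_def)

lemma coord_inv_eq_sph: "coord_inv x w = sph (chart_num x w) (chart_den x w)"
  by (cases x) (auto simp: chart_num_def chart_den_def coord_inv_def sph_def)

lemma coord_inv_coord_sph: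
  "q \<noteq> 0 \<Longrightarrow> coord_inv (Fin a) (coord (Fin a) (sph p q)) = sph p q"
  "p \<noteq> 0 \<Longrightarrow> coord_inv Infty (coord Infty (sph p q)) = sph p q"
  by (auto simp: coord_def coord_inv_def sph_def)

text \<open>
  In the charts a lifted map is \<open>P / Q\<close> near a finite value and \<open>Q / P\<close> near \<^const>\<open>Infty\<close>, so the
  quotient rule covers all positions of a point and its image at once.
\<close>
lemma has_sphere_deriv_lift:
  fixes P Q :: "complex \<Rightarrow> complex \<Rightarrow> complex"
  assumes lift: "lifts g P Q"
    and p: "((\<lambda>w. P (chart_num x w) (chart_den x w)) has_field_derivative p') (at (coord x x))"
    and q: "((\<lambda>w. Q (chart_num x w) (chart_den x w)) has_field_derivative q') (at (coord x x))"
    and P0: "P (chart_num x (coord x x)) (chart_den x (coord x x)) = p0"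
    and Q0: "Q (chart_num x (coord x x)) (chart_den x (coord x x)) = q0"
  shows "has_sphere_deriv g x (if q0 = 0 then q' / p0 else (p' * q0 - p0 * q') / q0\<^sup>2)"
proof -
  let ?p = "\<lambda>w. P (chart_num x w) (chart_den x w)" and ?q = "\<lambda>w. Q (chart_num x w) (chart_den x w)"
  let ?w0 = "coord x x"
  have g: "g (coord_inv x w) = sph (?p w) (?q w)" for w
    using liftsD[OF lift chart_nonzero] by (simp add: coord_inv_eq_sph)
  have gx: "g x = sph p0 q0" using g[of ?w0] P0 Q0 by simp
  have nz: "p0 \<noteq> 0 \<or> q0 \<noteq> 0" using liftsD(1)[OF lift chart_nonzero] P0 Q0 by blast
  show ?thesis
  proof (cases "q0 = 0")
    case False
    have "isCont ?q ?w0" using q by (rule DERIV_isCont)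
    then have "(?q \<longlongrightarrow> q0) (nhds ?w0)"
      unfolding Q0[symmetric] by (rule isCont_tendsto_nhds)
    then have ev: "\<forall>\<^sub>F w in nhds ?w0. ?q w \<noteq> 0"
      using False tendsto_imp_eventually_ne by blast
    have "((\<lambda>w. ?p w / ?q w) has_field_derivative (p' * q0 - p0 * q') / (q0 * q0)) (at ?w0)"
      using DERIV_divide[OF p q] False P0 Q0 by simp
    moreover have "\<forall>\<^sub>F w in nhds ?w0. ?p w / ?q w = coord (g x) (g (coord_inv x w))"
      using ev by eventually_elim (simp add: g gx sph_def False coord_def)
    ultimately have "((\<lambda>w. coord (g x) (g (coord_inv x w))) has_field_derivative
        (p' * q0 - p0 * q') / q0\<^sup>2) (at ?w0)"
      unfolding power2_eq_square by (rule DERIV_eventually_eq)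
    moreover have "\<forall>\<^sub>F w in nhds ?w0.
        coord_inv (g x) (coord (g x) (g (coord_inv x w))) = g (coord_inv x w)"
      using ev by eventually_elim (use False gx in \<open>simp add: g coord_inv_coord_sph sph_def[of p0]\<close>)
    ultimately show ?thesis using False by (simp add: has_sphere_deriv_def)
  next
    case True
    then have p0: "p0 \<noteq> 0" using nz by simp
    have "isCont ?p ?w0" using p by (rule DERIV_isCont)
    then have "(?p \<longlongrightarrow> p0) (nhds ?w0)"
      unfolding P0[symmetric] by (rule isCont_tendsto_nhds)
    then have ev: "\<forall>\<^sub>F w in nhds ?w0. ?p w \<noteq> 0"
      using p0 tendsto_imp_eventually_ne by blast
    have "((\<lambda>w. ?q w / ?p w) has_field_derivative q' / p0) (at ?w0)"
      using DERIV_divide[OF q p] p0 P0 Q0 True by simp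
    moreover have "\<forall>\<^sub>F w in nhds ?w0. ?q w / ?p w = coord (g x) (g (coord_inv x w))"
      using ev by eventually_elim (simp add: g gx sph_def True coord_def)
    ultimately have "((\<lambda>w. coord (g x) (g (coord_inv x w))) has_field_derivative q' / p0) (at ?w0)"
      by (rule DERIV_eventually_eq)
    moreover have "\<forall>\<^sub>F w in nhds ?w0.
        coord_inv (g x) (coord (g x) (g (coord_inv x w))) = g (coord_inv x w)"
      using ev by eventually_elim (use True gx in \<open>simp add: g coord_inv_coord_sph sph_def[of p0]\<close>)
    ultimately show ?thesis using True by (simp add: has_sphere_deriv_def)
  qed
qed

text \<open>
  Up to sign and a square in the denominator, the derivative is the determinant of the
  transformation.
\<close>
lemma moebius_has_sphere_deriv:
  assumes "moebius_transformation \<phi>"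
  obtains D where "D \<noteq> 0" "has_sphere_deriv \<phi> x D"
proof -
  obtain a b c d where det: "a * d - b * c \<noteq> 0"
      and lift: "lifts \<phi> (\<lambda>u v. a * u + b * v) (\<lambda>u v. c * u + d * v)"
    using moebius_lift[OF assms] .
  show ?thesis
  proof (cases x)
    case (Fin z)
    have "has_sphere_deriv \<phi> x (if c * z + d = 0 then c / (a * z + b)
        else (a * (c * z + d) - (a * z + b) * c) / (c * z + d)\<^sup>2)"
      by (rule has_sphere_deriv_lift[OF lift])
        (auto simp: Fin chart_num_def chart_den_def coord_def intro!: derivative_eq_intros)
    moreover have "a * (c * z + d) - (a * z + b) * c \<noteq> 0"
      using det by (simp add: algebra_simps)
    moreover have "c \<noteq> 0 \<and> a * z + b \<noteq> 0" if "c * z + d = 0"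
      using that calculation(2) det by auto
    ultimately show ?thesis by (cases "c * z + d = 0")
      (use that[of "c / (a * z + b)"]
        that[of "(a * (c * z + d) - (a * z + b) * c) / (c * z + d)\<^sup>2"] in auto)
  next
    case Infty
    have "has_sphere_deriv \<phi> x (if c = 0 then d / a else (b * c - a * d) / c\<^sup>2)"
      by (rule has_sphere_deriv_lift[OF lift])
        (auto simp: Infty chart_num_def chart_den_def coord_def intro!: derivative_eq_intros)
    moreover have "b * c - a * d \<noteq> 0" using det by auto
    moreover have "d \<noteq> 0 \<and> a \<noteq> 0" if "c = 0"
      using that det by auto
    ultimately show ?thesis by (cases "c = 0")
      (use that[of "d / a"] that[of "(b * c - a * d) / c\<^sup>2"] in auto)
  qed
qed

section \<open>Maps all of whose periodic multipliers are integers\<close>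

definition sphere_differentiable :: "(riemann_sphere \<Rightarrow> riemann_sphere) \<Rightarrow> bool" where
  "sphere_differentiable g \<longleftrightarrow> (\<forall>x. \<exists>D. has_sphere_deriv g x D)"

lemma has_sphere_deriv_id: "has_sphere_deriv id x 1"
proof -
  have "lifts id (\<lambda>u v. u) (\<lambda>u v. v)" by (auto simp: lifts_def)
  from has_sphere_deriv_lift[OF this, of x "case x of Fin _ \<Rightarrow> 1 | Infty \<Rightarrow> 0"
      "case x of Fin _ \<Rightarrow> 0 | Infty \<Rightarrow> 1" "chart_num x (coord x x)" "chart_den x (coord x x)"]
  show ?thesis
    by (cases x) (auto simp: chart_num_def chart_den_def coord_def)
qed

lemma sphere_differentiable_funpow:
  assumes "sphere_differentiable g"
  shows "\<exists>D. has_sphere_deriv (g ^^ n) x D"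
proof (induction n)
  case 0
  then show ?case using has_sphere_deriv_id[of x] by (auto simp: id_def)
next
  case (Suc n)
  then obtain D where "has_sphere_deriv (g ^^ n) x D" by blast
  moreover obtain E where "has_sphere_deriv g ((g ^^ n) x) E"
    using assms unfolding sphere_differentiable_def by blast
  ultimately have "has_sphere_deriv (g \<circ> (g ^^ n)) x (E * D)" by (rule has_sphere_deriv_comp)
  then show ?case unfolding funpow.simps by blast
qed

lemma has_sphere_deriv_fixed_funpow:
  assumes "has_sphere_deriv g x D" "g x = x"
  shows "has_sphere_deriv (g ^^ j) x (D ^ j)"
proof (induction j)
  case 0
  then show ?case using has_sphere_deriv_id[of x] by (simp add: id_def)
next
  case (Suc j)
  have "(g ^^ j) x = x" by (induction j) (use assms(2) in auto)
  then have "has_sphere_deriv (g \<circ> (g ^^ j)) x (D * D ^ j)"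
    using has_sphere_deriv_comp[OF Suc] assms(1) by simp
  then show ?case unfolding funpow.simps power_Suc .
qed

text \<open>
  The number \<open>n\<close> is any period of \<open>x\<close>, not only the least one. This costs nothing, since the
  derivative of a multiple period is a power of the multiplier, and it makes it unnecessary
  to check that the explicit cycles constructed below have exact period three or four.
\<close>
definition integral_periods :: "(riemann_sphere \<Rightarrow> riemann_sphere) \<Rightarrow> bool" where
  "integral_periods g \<longleftrightarrow>
     (\<forall>n\<ge>1. \<forall>x D. (g ^^ n) x = x \<longrightarrow> has_sphere_deriv (g ^^ n) x D \<longrightarrow> D \<in> \<int>)"

lemma integral_periods_if_only_integer_multipliers:
  assumes "only_integer_multipliers f" "sphere_differentiable f"
  shows "integral_periods f"
  unfolding integral_periods_def
proof (intro allI impI)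
  fix n :: nat and x D
  assume n: "n \<ge> 1" and per: "(f ^^ n) x = x" and D: "has_sphere_deriv (f ^^ n) x D"
  define k where "k = period f x"
  have ex: "\<exists>n. n \<ge> 1 \<and> (f ^^ n) x = x" using n per by blast
  have k: "k \<ge> 1" "(f ^^ k) x = x"
    using LeastI_ex[OF ex] by (simp_all add: k_def period_def)
  have "(f ^^ (n mod k)) x = x" using funpow_mod_eq[OF k(2)] per by metis
  moreover have "n mod k < k" using k by simp
  ultimately have "n mod k = 0"
    unfolding k_def period_def using not_less_Least
    by (metis (mono_tags, lifting) One_nat_def Suc_leI bot_nat_0.not_eq_extremum)
  then obtain j where j: "n = k * j" by auto
  obtain M where M: "has_sphere_deriv (f ^^ k) x M" using sphere_differentiable_funpow[OF assms(2)] by blast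
  have "multiplier f x = M"
    using M k(2) unfolding has_sphere_deriv_def multiplier_def differential_eigenvalue_def k_def
    by (simp add: DERIV_imp_deriv)
  moreover have "forward_orbit f x \<in> cycles f" "x \<in> forward_orbit f x"
    using ex unfolding cycles_def periodic_point_def forward_orbit_def
    by (auto intro: exI[of _ 0])
  ultimately have "M \<in> \<int>" using assms(1) unfolding only_integer_multipliers_def by blast
  moreover have "D = M ^ j"
    using has_sphere_deriv_fixed_funpow[OF M k(2), of j] D has_sphere_deriv_unique
    by (simp add: j funpow_mult)
  ultimately show "D \<in> \<int>" by simp
qed

lemma semiconjugate_funpow:
  assumes "\<phi> \<circ> f = g \<circ> \<phi>"
  shows "\<phi> \<circ> (f ^^ n) = (g ^^ n) \<circ> \<phi>"
proof (induction n)
  case (Suc n)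
  have "\<phi> \<circ> (f ^^ Suc n) = g \<circ> (\<phi> \<circ> (f ^^ n))"
    unfolding funpow.simps comp_assoc[symmetric] assms ..
  then show ?case unfolding Suc funpow.simps comp_assoc .
qed simp

text \<open>
  Both sides of \<open>\<phi> \<circ> f ^^ n = g ^^ n \<circ> \<phi>\<close> have a derivative at \<open>x\<close> by the chain rule, and the factor
  coming from \<open>\<phi>\<close> cancels. The map \<open>\<phi>\<close> may be any semiconjugacy that is unramified at \<open>x\<close>; besides
  Moebius transformations this will be used for squaring.
\<close>
lemma semiconjugate_multiplier:
  assumes semi: "\<phi> \<circ> f = g \<circ> \<phi>" and A: "has_sphere_deriv \<phi> x A" "A \<noteq> 0"
    and per: "(f ^^ n) x = x" and D: "has_sphere_deriv (f ^^ n) x D"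
    and E: "has_sphere_deriv (g ^^ n) (\<phi> x) E"
  shows "D = E"
proof -
  have "has_sphere_deriv (\<phi> \<circ> (f ^^ n)) x (A * D)"
    using has_sphere_deriv_comp[OF D] A(1) per by simp
  moreover have "has_sphere_deriv ((g ^^ n) \<circ> \<phi>) x (E * A)"
    by (rule has_sphere_deriv_comp[OF A(1) E])
  ultimately have "A * D = E * A"
    using has_sphere_deriv_unique semiconjugate_funpow[OF semi] by metis
  then show ?thesis using A(2) by simp
qed

lemma integral_periods_conjugate:
  assumes "conjugate_maps f g" "integral_periods f" "sphere_differentiable f"
  shows "integral_periods g"
  unfolding integral_periods_def
proof (intro allI impI)
  fix n :: nat and y E
  assume n: "n \<ge> 1" and per: "(g ^^ n) y = y" and E: "has_sphere_deriv (g ^^ n) y E"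
  obtain \<phi> where \<phi>: "moebius_transformation \<phi>" "\<phi> \<circ> f = g \<circ> \<phi>"
    using assms(1) unfolding conjugate_maps_def by blast
  obtain \<psi> where \<psi>: "\<phi> \<circ> \<psi> = id" "\<psi> \<circ> \<phi> = id" using moebius_inverse[OF \<phi>(1)] .
  have y: "\<phi> (\<psi> y) = y" using \<psi>(1) by (metis comp_apply id_apply)
  have "\<phi> ((f ^^ n) (\<psi> y)) = \<phi> (\<psi> y)"
    using semiconjugate_funpow[OF \<phi>(2), of n] per y by (metis comp_apply)
  then have fix': "(f ^^ n) (\<psi> y) = \<psi> y" using \<psi>(2) by (metis comp_apply id_apply)
  obtain D where D: "has_sphere_deriv (f ^^ n) (\<psi> y) D" using sphere_differentiable_funpow[OF assms(3)] by blast
  obtain A where "A \<noteq> 0" "has_sphere_deriv \<phi> (\<psi> y) A" using moebius_has_sphere_deriv[OF \<phi>(1)] .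
  then have "D = E" using semiconjugate_multiplier[OF \<phi>(2) _ _ fix' D] E y by simp
  moreover have "D \<in> \<int>" using assms(2) n fix' D unfolding integral_periods_def by blast
  ultimately show "E \<in> \<int>" by simp
qed

section \<open>Quadratic rational maps and their normal forms\<close>

definition qform :: "complex \<Rightarrow> complex \<Rightarrow> complex \<Rightarrow> complex \<Rightarrow> complex \<Rightarrow> complex" where
  "qform c2 c1 c0 u v = c2 * u\<^sup>2 + c1 * u * v + c0 * v\<^sup>2"

text \<open>
  Since the two forms have no common zero, this describes the rational maps of degree exactly
  two, without the bookkeeping about degrees and coprimality.
\<close>
definition quadratic :: "(riemann_sphere \<Rightarrow> riemann_sphere) \<Rightarrow> bool" where
  "quadratic g \<longleftrightarrow> (\<exists>p2 p1 p0 q2 q1 q0. lifts g (qform p2 p1 p0) (qform q2 q1 q0))"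

lemma sphere_differentiable_if_quadratic:
  assumes "quadratic g"
  shows "sphere_differentiable g"
  unfolding sphere_differentiable_def
proof
  fix x
  obtain p2 p1 p0 q2 q1 q0 where lift: "lifts g (qform p2 p1 p0) (qform q2 q1 q0)"
    using assms unfolding quadratic_def by blast
  show "\<exists>D. has_sphere_deriv g x D"
  proof (cases x)
    case (Fin z)
    show ?thesis
      by (rule exI, rule has_sphere_deriv_lift[OF lift,
            where p' = "2 * p2 * z + p1" and q' = "2 * q2 * z + q1"])
        (auto simp: Fin chart_num_def chart_den_def coord_def qform_def intro!: derivative_eq_intros)
  next
    case Infty
    show ?thesis
      by (rule exI, rule has_sphere_deriv_lift[OF lift, where p' = p1 and q' = q1])
        (auto simp: Infty chart_num_def chart_den_def coord_def qform_def intro!: derivative_eq_intros)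
  qed
qed

lemma poly_degree_le_2:
  fixes p :: "complex poly"
  assumes "degree p \<le> 2"
  shows "p = [:coeff p 0, coeff p 1, coeff p 2:]"
proof (rule poly_eqI)
  fix n :: nat
  consider "n = 0" | "n = 1" | "n = 2" | "n > 2" by linarith
  then show "coeff p n = coeff [:coeff p 0, coeff p 1, coeff p 2:] n"
  proof cases
    case 4
    then obtain k where "n = Suc (Suc (Suc k))" by (metis less_natE numeral_2_eq_2 plus_nat.simps(2))
    with 4 show ?thesis using assms by (simp add: coeff_eq_0)
  qed (simp_all add: numeral_2_eq_2)
qed

lemma quadratic_if_degree_2:
  assumes "rational_map_of_degree 2 f"
  shows "quadratic f"
proof -
  obtain p q where cop: "coprime p q" and deg: "max (degree p) (degree q) = 2" and f: "f = rat_fun p q"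
    using assms unfolding rational_map_of_degree_def by blast
  define p0 p1 p2 q0 q1 q2 where "p0 = coeff p 0" "p1 = coeff p 1" "p2 = coeff p 2"
    "q0 = coeff q 0" "q1 = coeff q 1" "q2 = coeff q 2"
  have p: "p = [:p0, p1, p2:]" and q: "q = [:q0, q1, q2:]"
    using poly_degree_le_2[of p] poly_degree_le_2[of q] deg
    unfolding p0_p1_p2_q0_q1_q2_def by linarith+
  have lead: "p2 \<noteq> 0 \<or> q2 \<noteq> 0"
  proof (rule ccontr)
    assume "\<not> ?thesis"
    then have "degree p \<le> 1" "degree q \<le> 1" by (auto simp: p q)
    then show False using deg by simp
  qed
  have noroot: "poly p z \<noteq> 0 \<or> poly q z \<noteq> 0" for z
    using coprime_poly_0[OF cop] by blast
  have hom: "poly p (u / v) = qform p2 p1 p0 u v / v\<^sup>2" "poly q (u / v) = qform q2 q1 q0 u v / v\<^sup>2"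
    if "v \<noteq> 0" for u v
    using that by (simp_all add: p q qform_def field_simps power2_eq_square)
  have "lifts f (qform p2 p1 p0) (qform q2 q1 q0)"
  proof (rule liftsI)
    fix u v :: complex
    assume uv: "u \<noteq> 0 \<or> v \<noteq> 0"
    show "qform p2 p1 p0 u v \<noteq> 0 \<or> qform q2 q1 q0 u v \<noteq> 0"
    proof (cases "v = 0")
      case True
      then show ?thesis using uv lead by (simp add: qform_def)
    next
      case False
      then show ?thesis using noroot[of "u / v"] hom[OF False, of u] by auto
    qed
    show "f (sph u v) = sph (qform p2 p1 p0 u v) (qform q2 q1 q0 u v)"
    proof (cases "v = 0")
      case True
      then show ?thesis using uv deg
        by (simp add: sph_def f rat_fun_def qform_def p0_p1_p2_q0_q1_q2_def)
    next
      case False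
      then show ?thesis using hom[OF False, of u]
        by (simp add: sph_def f rat_fun_def)
    qed
  qed
  then show ?thesis unfolding quadratic_def by blast
qed

lemma complex_cubic_root:
  fixes c0 c1 c2 c3 :: complex
  assumes "c3 \<noteq> 0"
  obtains x where "c3 * x ^ 3 + c2 * x\<^sup>2 + c1 * x + c0 = 0"
proof -
  have "\<not> constant (poly [:c0, c1, c2, c3:])"
    using assms by (simp add: constant_degree)
  then obtain x where "poly [:c0, c1, c2, c3:] x = 0"
    using fundamental_theorem_of_algebra by blast
  then show ?thesis
    by (intro that[of x]) (simp add: algebra_simps power2_eq_square power3_eq_cube)
qed

lemma complex_quadratic_roots:
  fixes b c :: complex
  obtains x y where "x + y = - b" "x * y = c"
proof -
  define d where "d = csqrt (b\<^sup>2 - 4 * c)"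
  have "d\<^sup>2 = b\<^sup>2 - 4 * c" by (simp add: d_def)
  then show ?thesis
    by (intro that[of "(- b + d) / 2" "(- b - d) / 2"]) (simp_all add: field_simps power2_eq_square)
qed

text \<open>
  The fixed points are the zeros of a cubic form, which vanishes at \<open>(1, 0)\<close> exactly when the
  corresponding cubic polynomial loses degree.
\<close>
lemma quadratic_fixed_point:
  assumes "quadratic g"
  obtains x where "g x = x"
proof -
  obtain p2 p1 p0 q2 q1 q0 where lift: "lifts g (qform p2 p1 p0) (qform q2 q1 q0)"
    using assms unfolding quadratic_def by blast
  have fixed: "g (sph u v) = sph u v"
    if "u \<noteq> 0 \<or> v \<noteq> 0" "qform p2 p1 p0 u v * v = u * qform q2 q1 q0 u v" for u v
    using liftsD[OF lift that(1)] that by (simp add: sph_eq_iff)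
  show ?thesis
  proof (cases "q2 = 0")
    case True
    then show ?thesis by (intro that[of "sph 1 0"] fixed) (auto simp: qform_def)
  next
    case False
    then obtain z where "q2 * z ^ 3 + (q1 - p2) * z\<^sup>2 + (q0 - p1) * z + (- p0) = 0"
      by (rule complex_cubic_root)
    then show ?thesis
      by (intro that[of "sph z 1"] fixed)
        (auto simp: qform_def algebra_simps power2_eq_square power3_eq_cube)
  qed
qed

definition quad_poly :: "complex \<Rightarrow> riemann_sphere \<Rightarrow> riemann_sphere" where
  "quad_poly c x = (case x of Fin z \<Rightarrow> Fin (z\<^sup>2 + c) | Infty \<Rightarrow> Infty)"

text \<open>
  Every quadratic map with a fixed point of multiplier \<open>1 / a \<noteq> 0\<close> can be brought into this form with
  the fixed point at infinity and the finite pole at \<open>0\<close>; only the sign of \<open>b\<close> is then still free.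
\<close>
definition mixed_form :: "complex \<Rightarrow> complex \<Rightarrow> riemann_sphere \<Rightarrow> riemann_sphere" where
  "mixed_form a b x =
     (case x of Fin z \<Rightarrow> if z = 0 then Infty else Fin (a * z + b + 1 / z) | Infty \<Rightarrow> Infty)"

lemma lifts_quad_poly: "lifts (quad_poly c) (qform 1 0 c) (qform 0 0 1)"
proof (rule liftsI)
  fix u v :: complex
  show "quad_poly c (sph u v) = sph (qform 1 0 c u v) (qform 0 0 1 u v)"
    by (auto simp: sph_def quad_poly_def qform_def field_simps power2_eq_square)
qed (auto simp: qform_def)

lemma lifts_mixed_form:
  assumes "a \<noteq> 0"
  shows "lifts (mixed_form a b) (qform a b 1) (qform 0 1 0)"
proof (rule liftsI)
  fix u v :: complex
  show "mixed_form a b (sph u v) = sph (qform a b 1 u v) (qform 0 1 0 u v)"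
    by (auto simp: sph_def mixed_form_def qform_def field_simps power2_eq_square)
qed (use assms in \<open>auto simp: qform_def\<close>)

lemma quadratic_mixed_form: "a \<noteq> 0 \<Longrightarrow> quadratic (mixed_form a b)"
  using lifts_mixed_form unfolding quadratic_def by blast

lemma mixed_form_deriv_Fin:
  assumes "a \<noteq> 0" "z \<noteq> 0"
  shows "has_sphere_deriv (mixed_form a b) (Fin z) (a - 1 / z\<^sup>2)"
proof -
  have "has_sphere_deriv (mixed_form a b) (Fin z) (if z = 0 then 1 / (a * z\<^sup>2 + b * z + 1)
      else ((2 * a * z + b) * z - (a * z\<^sup>2 + b * z + 1) * 1) / z\<^sup>2)"
    by (rule has_sphere_deriv_lift[OF lifts_mixed_form[OF assms(1), of b]])
      (auto simp: chart_num_def chart_den_def coord_def qform_def intro!: derivative_eq_intros)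
  moreover have "((2 * a * z + b) * z - (a * z\<^sup>2 + b * z + 1) * 1) / z\<^sup>2 = a - 1 / z\<^sup>2"
    using assms(2) by (simp add: field_simps power2_eq_square)
  ultimately show ?thesis using assms(2) by simp
qed

lemma quad_poly_deriv_Fin: "has_sphere_deriv (quad_poly c) (Fin z) (2 * z)"
proof -
  have "has_sphere_deriv (quad_poly c) (Fin z) (if (1::complex) = 0 then 0 / (z\<^sup>2 + c)
      else ((2 * z) * 1 - (z\<^sup>2 + c) * 0) / 1\<^sup>2)"
    by (rule has_sphere_deriv_lift[OF lifts_quad_poly])
      (auto simp: chart_num_def chart_den_def coord_def qform_def intro!: derivative_eq_intros)
  then show ?thesis by simp
qed

lemma conjugate_fixing_Infty:
  assumes "quadratic g" "g x = x"
  obtains \<phi> h where "moebius_transformation \<phi>" "\<phi> \<circ> g = h \<circ> \<phi>" "\<phi> x = Infty" "quadratic h"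
proof (cases x)
  case Infty
  have "lifts id (\<lambda>u v. 1 * u + 0 * v) (\<lambda>u v. 0 * u + 1 * v)" by (auto simp: lifts_def)
  then have "moebius_transformation id" by (rule moebius_of_lift[rotated]) simp
  then show ?thesis using that[of id g] assms Infty by simp
next
  case (Fin z)
  obtain p2 p1 p0 q2 q1 q0 where lift: "lifts g (qform p2 p1 p0) (qform q2 q1 q0)"
    using assms unfolding quadratic_def by blast
  define \<phi> where "\<phi> = rat_fun [:1, 0:] [:- z, 1:]"
  have lift\<phi>: "lifts \<phi> (\<lambda>u v. 0 * u + 1 * v) (\<lambda>u v. 1 * u + (- z) * v)"
    unfolding \<phi>_def by (rule lifts_rat_fun_linear) simp
  have \<phi>: "moebius_transformation \<phi>" by (rule moebius_of_lift[OF _ lift\<phi>]) simp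
  define \<psi> where "\<psi> = rat_fun [:1, z:] [:0, 1:]"
  have lift\<psi>: "lifts \<psi> (\<lambda>u v. z * u + 1 * v) (\<lambda>u v. 1 * u + 0 * v)"
    unfolding \<psi>_def by (rule lifts_rat_fun_linear) simp
  have id: "lifts id (\<lambda>u v. u) (\<lambda>u v. v)" by (auto simp: lifts_def)
  have inv: "\<psi> \<circ> \<phi> = id"
    by (rule lifts_eqI[OF lifts_comp[OF lift\<phi> lift\<psi>] id]) (simp add: algebra_simps)
  have "lifts (\<phi> \<circ> (g \<circ> \<psi>))
      (qform (q2 * z\<^sup>2 + q1 * z + q0) (2 * q2 * z + q1) q2)
      (qform (p2 * z\<^sup>2 + p1 * z + p0 - z * (q2 * z\<^sup>2 + q1 * z + q0))
        (2 * p2 * z + p1 - z * (2 * q2 * z + q1)) (p2 - z * q2))"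
    using lifts_comp[OF lifts_comp[OF lift\<psi> lift] lift\<phi>]
    by (simp add: qform_def[abs_def] algebra_simps power2_eq_square)
  then have "quadratic (\<phi> \<circ> (g \<circ> \<psi>))" unfolding quadratic_def by blast
  moreover have "\<phi> \<circ> g = (\<phi> \<circ> (g \<circ> \<psi>)) \<circ> \<phi>" using inv by (simp add: comp_assoc)
  moreover have "\<phi> x = Infty" using liftsD(2)[OF lift\<phi>, of z 1] by (simp add: Fin sph_def)
  ultimately show ?thesis using that \<phi> by blast
qed

text \<open>
  If infinity is fixed, the denominator is at most linear. It is constant when the multiplier
  vanishes, and completing the square gives \<open>z\<^sup>2 + c\<close>. Otherwise there is one finite pole; moving
  it to \<open>0\<close> and rescaling its residue to \<open>1\<close> gives the mixed form.
\<close>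
lemma normal_form_Infty:
  assumes quad: "quadratic h" and per: "h Infty = Infty" and D: "has_sphere_deriv h Infty \<nu>"
  shows "if \<nu> = 0 then (\<exists>c. conjugate_maps h (quad_poly c))
         else (\<exists>b. conjugate_maps h (mixed_form (1 / \<nu>) b))"
proof -
  obtain p2 p1 p0 q2 q1 q0 where lift: "lifts h (qform p2 p1 p0) (qform q2 q1 q0)"
    using quad unfolding quadratic_def by blast
  have "sph p2 q2 = Infty" "p2 \<noteq> 0 \<or> q2 \<noteq> 0"
    using liftsD[OF lift, of 1 0] per by (auto simp: qform_def sph_def)
  then have q2: "q2 = 0" and p2: "p2 \<noteq> 0" by (auto simp: sph_def split: if_splits)
  have "has_sphere_deriv h Infty (if q2 = 0 then q1 / p2 else (p1 * q2 - p2 * q1) / q2\<^sup>2)"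
    by (rule has_sphere_deriv_lift[OF lift])
      (auto simp: chart_num_def chart_den_def coord_def qform_def intro!: derivative_eq_intros)
  then have \<nu>: "\<nu> = q1 / p2" using D has_sphere_deriv_unique q2 by simp
  show ?thesis
  proof (cases "\<nu> = 0")
    case True
    then have q1: "q1 = 0" using \<nu> p2 by simp
    have q0: "q0 \<noteq> 0"
    proof
      assume "q0 = 0"
      obtain x y where "x + y = - (p1 / p2)" "x * y = p0 / p2" by (rule complex_quadratic_roots)
      then have p1: "p1 = - (p2 * (x + y))" and p0: "p0 = p2 * (x * y)"
        using p2 by (simp_all add: field_simps)
      have "qform p2 p1 p0 x 1 = 0"
        unfolding p1 p0 by (simp add: qform_def algebra_simps power2_eq_square)
      then show False using liftsD(1)[OF lift, of x 1] by (simp add: qform_def q1 q2 \<open>q0 = 0\<close>)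
    qed
    \<comment> \<open>The factor \<open>A\<close> makes the map monic and the shift \<open>B\<close> completes the square.\<close>
    define A B where "A = p2 / q0" and "B = p1 / (2 * q0)"
    define c where "c = p0 * p2 / q0\<^sup>2 + B - B\<^sup>2"
    define \<phi> where "\<phi> = rat_fun [:B, A:] [:1, 0:]"
    have A: "A \<noteq> 0" using p2 q0 by (simp add: A_def)
    have lift\<phi>: "lifts \<phi> (\<lambda>u v. A * u + B * v) (\<lambda>u v. 0 * u + 1 * v)"
      unfolding \<phi>_def by (rule lifts_rat_fun_linear) (use A in simp)
    have "\<phi> \<circ> h = quad_poly c \<circ> \<phi>"
    proof (rule lifts_eqI[OF lifts_comp[OF lift lift\<phi>] lifts_comp[OF lift\<phi> lifts_quad_poly]])
      fix u v
      have "p2 = A * q0" "p1 = 2 * B * q0" "p0 * A = (c - B + B\<^sup>2) * q0"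
        using q0 by (simp_all add: A_def B_def c_def field_simps power2_eq_square)
      then show "(A * qform p2 p1 p0 u v + B * qform q2 q1 q0 u v) *
            qform 0 0 1 (A * u + B * v) (0 * u + 1 * v)
          = qform 1 0 c (A * u + B * v) (0 * u + 1 * v) *
            (0 * qform p2 p1 p0 u v + 1 * qform q2 q1 q0 u v)"
        unfolding qform_def q1 q2 by algebra
    qed
    moreover have "moebius_transformation \<phi>"
      by (rule moebius_of_lift[OF _ lift\<phi>]) (use A in simp)
    ultimately have "conjugate_maps h (quad_poly c)" unfolding conjugate_maps_def by blast
    then show ?thesis using True by auto
  next
    case False
    then have q1: "q1 \<noteq> 0" using \<nu> by auto
    \<comment> \<open>The pole is \<open>- r\<close>, and \<open>H\<close> is the value of the numerator there.\<close>
    define r where "r = q0 / q1"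
    define H where "H = p2 * r\<^sup>2 - p1 * r + p0"
    have q0: "q0 = q1 * r" using q1 by (simp add: r_def)
    have H: "H \<noteq> 0"
      using liftsD(1)[OF lift, of "- r" 1] by (simp add: qform_def q2 q0 H_def)
    define k where "k = csqrt (q1 / H)"
    have k2: "k\<^sup>2 = q1 / H" by (simp add: k_def)
    have k: "k \<noteq> 0" using k2 q1 H by auto
    define b where "b = k * (p1 - 2 * p2 * r + q0) / q1"
    define \<phi> where "\<phi> = rat_fun [:k * r, k:] [:1, 0:]"
    have lift\<phi>: "lifts \<phi> (\<lambda>u v. k * u + (k * r) * v) (\<lambda>u v. 0 * u + 1 * v)"
      unfolding \<phi>_def by (rule lifts_rat_fun_linear) (use k in simp)
    have a: "1 / \<nu> \<noteq> 0" using False by simp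
    have "\<phi> \<circ> h = mixed_form (1 / \<nu>) b \<circ> \<phi>"
    proof (rule lifts_eqI[OF lifts_comp[OF lift lift\<phi>] lifts_comp[OF lift\<phi> lifts_mixed_form[OF a]]])
      fix u v
      define a' where "a' = 1 / \<nu>"
      have e: "p2 = a' * q1" "b * q1 = k * (p1 - 2 * p2 * r + q1 * r)"
          "H * k\<^sup>2 = q1" "p0 = H - p2 * r\<^sup>2 + p1 * r"
        using q1 p2 H k2 by (simp_all add: a'_def b_def \<nu> q0 H_def)
      have "(k * qform p2 p1 p0 u v + (k * r) * qform q2 q1 q0 u v) * k
          = q1 * qform a' b 1 (k * u + (k * r) * v) v"
        using e unfolding qform_def q2 q0 by algebra
      moreover have "qform 0 1 0 (k * u + (k * r) * v) v * q1 = k * qform q2 q1 q0 u v"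
        unfolding qform_def q2 q0 by algebra
      ultimately have "((k * qform p2 p1 p0 u v + (k * r) * qform q2 q1 q0 u v) *
          qform 0 1 0 (k * u + (k * r) * v) v) * (k * q1)
        = (qform a' b 1 (k * u + (k * r) * v) v * qform q2 q1 q0 u v) * (k * q1)"
        by algebra
      then show "(k * qform p2 p1 p0 u v + (k * r) * qform q2 q1 q0 u v) *
          qform 0 1 0 (k * u + (k * r) * v) (0 * u + 1 * v)
        = qform (1 / \<nu>) b 1 (k * u + (k * r) * v) (0 * u + 1 * v) *
          (0 * qform p2 p1 p0 u v + 1 * qform q2 q1 q0 u v)"
        using k q1 by (simp add: a'_def)
    qed
    moreover have "moebius_transformation \<phi>"
      by (rule moebius_of_lift[OF _ lift\<phi>]) (use k in simp)
    ultimately have "conjugate_maps h (mixed_form (1 / \<nu>) b)" unfolding conjugate_maps_def by blast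
    then show ?thesis using False by auto
  qed
qed

lemma normal_form:
  assumes quad: "quadratic g" and per: "g x = x" and D: "has_sphere_deriv g x \<nu>"
  shows "\<nu> = 0 \<Longrightarrow> \<exists>c. conjugate_maps g (quad_poly c)"
    and "\<nu> \<noteq> 0 \<Longrightarrow> \<exists>b. conjugate_maps g (mixed_form (1 / \<nu>) b)"
proof -
  obtain \<phi> h where \<phi>: "moebius_transformation \<phi>" "\<phi> \<circ> g = h \<circ> \<phi>" "\<phi> x = Infty"
      and h: "quadratic h"
    using conjugate_fixing_Infty[OF quad per] .
  have hI: "h Infty = Infty" using \<phi>(2,3) per by (metis comp_apply)
  obtain E where E: "has_sphere_deriv h Infty E"
    using sphere_differentiable_if_quadratic[OF h] unfolding sphere_differentiable_def by blast
  obtain A where A: "A \<noteq> 0" "has_sphere_deriv \<phi> x A" using moebius_has_sphere_deriv[OF \<phi>(1)] .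
  have "\<nu> = E"
    by (rule semiconjugate_multiplier[OF \<phi>(2) A(2,1), of 1]) (use per D E \<phi>(3) in auto)
  then have *: "if \<nu> = 0 then (\<exists>c. conjugate_maps h (quad_poly c))
         else (\<exists>b. conjugate_maps h (mixed_form (1 / \<nu>) b))"
    using normal_form_Infty[OF h hI E] by simp
  have "conjugate_maps g h" using \<phi> unfolding conjugate_maps_def by blast
  then show "\<nu> = 0 \<Longrightarrow> \<exists>c. conjugate_maps g (quad_poly c)"
    and "\<nu> \<noteq> 0 \<Longrightarrow> \<exists>b. conjugate_maps g (mixed_form (1 / \<nu>) b)"
    using * conjugate_maps_trans by auto
qed

section \<open>Multipliers along explicit cycles\<close>

lemma has_sphere_deriv_cycle:
  assumes "\<And>i. i < n \<Longrightarrow> g (X i) = X (Suc i)"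
    and "\<And>i. i < n \<Longrightarrow> has_sphere_deriv g (X i) (D i)"
  shows "(g ^^ n) (X 0) = X n \<and> has_sphere_deriv (g ^^ n) (X 0) (\<Prod>i<n. D i)"
  using assms
proof (induction n)
  case 0
  then show ?case using has_sphere_deriv_id by (simp add: id_def)
next
  case (Suc n)
  then have IH: "(g ^^ n) (X 0) = X n" "has_sphere_deriv (g ^^ n) (X 0) (\<Prod>i<n. D i)" by auto
  have "has_sphere_deriv (g \<circ> (g ^^ n)) (X 0) (D n * (\<Prod>i<n. D i))"
    by (rule has_sphere_deriv_comp[OF IH(2)]) (simp add: IH(1) Suc.prems)
  moreover have "(g ^^ Suc n) (X 0) = X (Suc n)" using IH(1) Suc.prems by simp
  moreover have "(\<Prod>i<Suc n. D i) = D n * (\<Prod>i<n. D i)" by (simp add: mult.commute)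
  ultimately show ?case unfolding funpow.simps by metis
qed

lemma integral_3_cycle:
  assumes "integral_periods g" "g x = y" "g y = z" "g z = x"
    and "has_sphere_deriv g x A" "has_sphere_deriv g y B" "has_sphere_deriv g z C"
  shows "A * B * C \<in> \<int>"
proof -
  have "(g ^^ 3) ([x, y, z, x] ! 0) = [x, y, z, x] ! 3 \<and>
      has_sphere_deriv (g ^^ 3) ([x, y, z, x] ! 0) (\<Prod>i<3. [A, B, C] ! i)"
    by (rule has_sphere_deriv_cycle) (use assms in \<open>auto simp: less_Suc_eq numeral_3_eq_3\<close>)
  then have "(g ^^ 3) x = x \<and> has_sphere_deriv (g ^^ 3) x (A * B * C)"
    by (simp add: eval_nat_numeral mult.assoc)
  then show ?thesis using assms(1) unfolding integral_periods_def by (meson one_le_numeral)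
qed

lemma integral_fixed_point:
  assumes "integral_periods g" "g x = x" "has_sphere_deriv g x D"
  shows "D \<in> \<int>"
proof -
  have "(g ^^ 1) x = x" "has_sphere_deriv (g ^^ 1) x D" using assms by simp_all
  then show ?thesis using assms(1) unfolding integral_periods_def by (meson order_refl)
qed

lemma mixed_form_Fin: "z \<noteq> 0 \<Longrightarrow> mixed_form a b (Fin z) = Fin (a * z + b + 1 / z)"
  by (simp add: mixed_form_def)

section \<open>Cycles of period three\<close>

text \<open>
  Eliminating the other symmetric functions from the equations of a 3-cycle of \<open>z\<^sup>2 + c\<close> shows that
  the sum \<open>s\<close> of its points satisfies \<open>s\<^sup>2 + s + c + 2 = 0\<close> and determines the cubic whose roots form
  the cycle. Conversely, each root \<open>v\<close> of that cubic satisfies \<open>v + f v + f (f v) = s\<close> and \<open>f v\<close> is again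
  a root; applying this at \<open>v\<close> and at \<open>f v\<close> gives \<open>f (f (f v)) = v\<close>. The multiplier is eight times the
  product of the roots.
\<close>
lemma quad_poly_3_cycle:
  assumes "integral_periods (quad_poly c)" and s: "s\<^sup>2 + s + c + 2 = 0"
  shows "8 * (c * s + c + 1) \<in> \<int>"
proof -
  obtain x where "1 * x ^ 3 + (- s) * x\<^sup>2 + (c - 1 - s) * x + (- (c * s + c + 1)) = 0"
    by (rule complex_cubic_root[of 1]) simp
  then have x: "x ^ 3 - s * x\<^sup>2 + (c - 1 - s) * x - (c * s + c + 1) = 0" by algebra
  have third: "(v\<^sup>2 + c)\<^sup>2 + c = s - v - (v\<^sup>2 + c)"
    if "v ^ 3 - s * v\<^sup>2 + (c - 1 - s) * v - (c * s + c + 1) = 0" for v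
    using that s by algebra
  define y z where "y = x\<^sup>2 + c" and "z = s - x - y"
  have y: "y ^ 3 - s * y\<^sup>2 + (c - 1 - s) * y - (c * s + c + 1) = 0"
    using x s unfolding y_def by algebra
  have fy: "y\<^sup>2 + c = z" using third[OF x] by (simp add: y_def z_def)
  have fz: "z\<^sup>2 + c = x" using third[OF y] fy by (simp add: z_def)
  have "2 * x * (2 * y) * (2 * z) \<in> \<int>"
    by (rule integral_3_cycle[OF assms(1), of "Fin x" "Fin y" "Fin z"])
      (use fy fz in \<open>simp_all add: quad_poly_deriv_Fin, simp_all add: quad_poly_def y_def\<close>)
  moreover have "x * y * z = c * s + c + 1"
    using x s unfolding z_def y_def by algebra
  then have "2 * x * (2 * y) * (2 * z) = 8 * (c * s + c + 1)" by algebra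
  ultimately show ?thesis by simp
qed

text \<open>
  The same method for \<open>z + b + 1 / z\<close>. The sum \<open>s\<close> of the points of a 3-cycle satisfies
  \<open>s\<^sup>2 + 4 * b * s + 3 * b\<^sup>2 + 3 = 0\<close>; in terms of \<open>t = s + b\<close> this is the hypothesis, and the cubic with the cycle as
  its roots takes the compact form \<open>3 * X * (X + b) * (X - t) = t\<close>.
\<close>
lemma parabolic_3_cycle:
  assumes "integral_periods (mixed_form 1 b)" and t: "t\<^sup>2 + 2 * b * t + 3 = 0"
  obtains M where "M \<in> \<int>" "(M - 19 + 12 * b\<^sup>2) * t = - 6 * b ^ 3"
proof -
  have t0: "t \<noteq> 0" using t by auto
  obtain x where "3 * x ^ 3 + (3 * b - 3 * t) * x\<^sup>2 + (- 3 * b * t) * x + (- t) = 0"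
    by (rule complex_cubic_root[of 3]) simp
  then have x: "3 * x * (x + b) * (x - t) = t" by (simp add: algebra_simps power2_eq_square power3_eq_cube)
  have root0: "v \<noteq> 0" if "3 * v * (v + b) * (v - t) = t" for v
    using that t0 by auto
  define f where "f v = v + b + 1 / v" for v
  have f: "t * f v = (3 * v - 2 * t) * (v + b)" if v: "3 * v * (v + b) * (v - t) = t" for v
  proof -
    have "v * f v = v\<^sup>2 + b * v + 1"
      using root0[OF v] by (simp add: f_def field_simps power2_eq_square)
    then have "v * (t * f v) = v * ((3 * v - 2 * t) * (v + b))" using v by algebra
    then show ?thesis using root0[OF v] by simp
  qed
  have f_root: "3 * f v * (f v + b) * (f v - t) = t" if v: "3 * v * (v + b) * (v - t) = t" for v
  proof -
    define y where "y = f v"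
    have "v * y = v\<^sup>2 + b * v + 1"
      using root0[OF v] by (simp add: y_def f_def field_simps power2_eq_square)
    moreover have "t * y = (3 * v - 2 * t) * (v + b)" using f[OF v] by (simp add: y_def)
    ultimately have "t ^ 3 * (3 * y * (y + b) * (y - t) - t) = 0" using v t by algebra
    then show ?thesis using t0 by (simp add: y_def)
  qed
  have third: "f (f v) = t - b - v - f v" if v: "3 * v * (v + b) * (v - t) = t" for v
  proof -
    define y where "y = f v"
    have y0: "y \<noteq> 0" using root0[OF f_root[OF v]] by (simp add: y_def)
    have "v * y = v\<^sup>2 + b * v + 1"
      using root0[OF v] by (simp add: y_def f_def field_simps power2_eq_square)
    moreover have "t * y = (3 * v - 2 * t) * (v + b)" using f[OF v] by (simp add: y_def)
    ultimately have "t ^ 2 * (y * (t - b - v - y) - (y\<^sup>2 + b * y + 1)) = 0" using v t by algebra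
    then have "y * (t - b - v - y) = y\<^sup>2 + b * y + 1" using t0 by simp
    moreover have "y * f y = y\<^sup>2 + b * y + 1"
      using y0 by (simp add: f_def field_simps power2_eq_square)
    ultimately have "f y = t - b - v - y" using y0 by (metis mult_left_cancel)
    then show ?thesis by (simp add: y_def)
  qed
  define y z where "y = f x" and "z = f y"
  have roots: "3 * y * (y + b) * (y - t) = t" "3 * z * (z + b) * (z - t) = t"
    using f_root x by (auto simp: y_def z_def)
  have nz: "x \<noteq> 0" "y \<noteq> 0" "z \<noteq> 0" using root0 x roots by auto
  have sum: "x + y + z = t - b" using third[OF x] by (simp add: y_def z_def)
  have "f z = t - b - y - z" using third[OF roots(1)] by (simp add: z_def)
  then have fz: "f z = x" using sum by algebra
  define M where "M = (1 - 1 / x\<^sup>2) * (1 - 1 / y\<^sup>2) * (1 - 1 / z\<^sup>2)"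
  have "M \<in> \<int>"
    unfolding M_def
    by (rule integral_3_cycle[OF assms(1), of "Fin x" "Fin y" "Fin z"])
      (use nz fz in \<open>simp_all add: mixed_form_deriv_Fin, simp_all add: mixed_form_Fin y_def z_def f_def\<close>)
  have steps: "x * y = x\<^sup>2 + b * x + 1" "y * z = y\<^sup>2 + b * y + 1" "z * x = z\<^sup>2 + b * z + 1"
  proof -
    have "v * f v = v\<^sup>2 + b * v + 1" if "v \<noteq> 0" for v
      using that by (simp add: f_def field_simps power2_eq_square)
    from this[OF nz(1)] this[OF nz(2)] this[OF nz(3)]
    show "x * y = x\<^sup>2 + b * x + 1" "y * z = y\<^sup>2 + b * y + 1" "z * x = z\<^sup>2 + b * z + 1"
      unfolding fz unfolding y_def[symmetric] unfolding z_def[symmetric] .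
  qed
  \<comment> \<open>The elementary symmetric functions of the cycle determine the multiplier.\<close>
  have e2: "x * y + y * z + z * x = - b * t"
  proof -
    have "3 * (x * y + y * z + z * x) = (x + y + z)\<^sup>2 + b * (x + y + z) + 3"
      using steps by algebra
    then have "3 * (x * y + y * z + z * x) = 3 * (- b * t)" using sum t by algebra
    then show ?thesis by (subst (asm) mult_cancel_left) simp
  qed
  have e3: "3 * (x * y * z) = t"
    using e2 sum x by algebra
  have "M * (x * y * z)\<^sup>2 = (x\<^sup>2 - 1) * (y\<^sup>2 - 1) * (z\<^sup>2 - 1)"
    using nz by (simp add: M_def field_simps)
  also have "\<dots> = (x * y * z + (x + y + z))\<^sup>2 - (x * y + y * z + z * x + 1)\<^sup>2" by algebra
  finally have "M * t\<^sup>2 = (t + 3 * (t - b))\<^sup>2 - 9 * (1 - b * t)\<^sup>2"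
    using sum e2 e3 by algebra
  then have "t * ((M - 19 + 12 * b\<^sup>2) * t) = t * (- 6 * b ^ 3)" using t by algebra
  then have "(M - 19 + 12 * b\<^sup>2) * t = - 6 * b ^ 3"
    using t0 by (subst (asm) mult_cancel_left) simp
  with \<open>M \<in> \<int>\<close> show ?thesis using that by blast
qed

section \<open>Cycles of period four\<close>

text \<open>
  Along a 4-cycle \<open>x, y, z, w\<close> the map \<open>f\<close> takes the pair \<open>{x, z}\<close> to \<open>{y, w}\<close> and back. Its slope
  between \<open>x\<close> and \<open>z\<close> is \<open>\<alpha> = a - 1 / (x * z)\<close>, and its slope between \<open>y\<close> and \<open>w\<close> is \<open>- 1 / \<alpha> = - \<gamma>\<close>, because two
  steps exchange \<open>x\<close> and \<open>z\<close>. Hence the products \<open>x * z\<close> and \<open>y * w\<close> are \<open>1 / (a - \<alpha>)\<close> and \<open>1 / (a + \<gamma>)\<close>. The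
  hypotheses relate the sums \<open>s = x + z\<close> and \<open>s' = y + w\<close> and express \<open>(y - w)\<^sup>2 = \<alpha>\<^sup>2 * (x - z)\<^sup>2\<close>. They
  suffice: the points are recovered as the roots of two quadratic equations.
\<close>
lemma mixed_form_4_cycle:
  assumes a: "a \<noteq> 0" and \<alpha>: "\<alpha> * \<gamma> = 1" and nz: "a - \<alpha> \<noteq> 0" "a + \<gamma> \<noteq> 0"
    and s': "s' = (2 * a - \<alpha>) * s + 2 * b" and s: "s = (2 * a + \<gamma>) * s' + 2 * b"
    and disc: "s'\<^sup>2 - 4 / (a + \<gamma>) = \<alpha>\<^sup>2 * (s\<^sup>2 - 4 / (a - \<alpha>))"
  obtains u where "u \<noteq> 0" "(mixed_form a b ^^ 4) (Fin u) = Fin u"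
    "has_sphere_deriv (mixed_form a b ^^ 4) (Fin u)
      (((2 * a - \<alpha>)\<^sup>2 - a * (a - \<alpha>)\<^sup>2 * s\<^sup>2) * ((2 * a + \<gamma>)\<^sup>2 - a * (a + \<gamma>)\<^sup>2 * s'\<^sup>2))"
proof -
  define f where "f v = a * v + b + 1 / v" for v
  have pair: "f p + f q = (a + r) * (p + q) + 2 * b" "f p - f q = (a - r) * (p - q)"
      "(a - 1 / p\<^sup>2) * (a - 1 / q\<^sup>2) = (a + r)\<^sup>2 - a * r\<^sup>2 * (p + q)\<^sup>2"
    if pq: "p * q * r = 1" for p q r
  proof -
    have "p * q \<noteq> 0" using pq by auto
    then have "p \<noteq> 0" "q \<noteq> 0" and r: "r = 1 / (p * q)" using pq by (auto simp: nonzero_eq_divide_eq mult.commute)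
    then show "f p + f q = (a + r) * (p + q) + 2 * b" "f p - f q = (a - r) * (p - q)"
      "(a - 1 / p\<^sup>2) * (a - 1 / q\<^sup>2) = (a + r)\<^sup>2 - a * r\<^sup>2 * (p + q)\<^sup>2"
      unfolding f_def r by (simp_all add: field_simps power2_eq_square)
  qed
  obtain x z where xz: "x + z = s" "x * z = 1 / (a - \<alpha>)"
    using complex_quadratic_roots[of "- s" "1 / (a - \<alpha>)"] by auto
  have xz1: "x * z * (a - \<alpha>) = 1" using xz nz by simp
  define y w where "y = f x" and "w = f z"
  have yw: "y + w = s'" "y - w = \<alpha> * (x - z)"
    using pair(1,2)[OF xz1] by (simp_all add: y_def w_def s' xz)
  have "4 * (y * w) = (y + w)\<^sup>2 - (y - w)\<^sup>2" by algebra
  also have "\<dots> = s'\<^sup>2 - \<alpha>\<^sup>2 * ((x + z)\<^sup>2 - 4 * (x * z))" unfolding yw by algebra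
  also have "\<dots> = s'\<^sup>2 - \<alpha>\<^sup>2 * (s\<^sup>2 - 4 / (a - \<alpha>))" by (simp add: xz)
  also have "\<dots> = 4 / (a + \<gamma>)" unfolding disc[symmetric] by simp
  finally have "4 * (y * w) * (a + \<gamma>) = 4"
    by (rule nonzero_eq_divide_eq[OF nz(2), THEN iffD1])
  then have "4 * (y * w * (a + \<gamma>)) = 4 * 1" by (simp only: mult.assoc mult_1_right)
  then have yw1: "y * w * (a + \<gamma>) = 1" by (subst (asm) mult_cancel_left) simp
  have sd: "f y + f w = s" "f y - f w = z - x"
    using pair(1,2)[OF yw1] yw s \<alpha> by (simp_all add: algebra_simps) algebra+
  have "2 * f y = (f y + f w) + (f y - f w)" "2 * f w = (f y + f w) - (f y - f w)" by simp_all
  then have "2 * f y = 2 * z" "2 * f w = 2 * x" unfolding sd xz(1)[symmetric] by simp_all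
  then have fy: "f y = z" "f w = x" by simp_all
  have nz': "x \<noteq> 0" "y \<noteq> 0" "z \<noteq> 0" "w \<noteq> 0" using xz1 yw1 by auto
  define X where "X i = Fin ([x, y, z, w, x] ! i)" for i
  define D where "D i = a - 1 / ([x, y, z, w] ! i)\<^sup>2" for i
  have "(mixed_form a b ^^ 4) (X 0) = X 4 \<and>
      has_sphere_deriv (mixed_form a b ^^ 4) (X 0) (\<Prod>i<4. D i)"
  proof (rule has_sphere_deriv_cycle)
    fix i :: nat
    assume "i < 4"
    then consider "i = 0" | "i = 1" | "i = 2" | "i = 3" by linarith
    note c = this
    show "mixed_form a b (X i) = X (Suc i)"
      using c by cases (use nz' fy in
        \<open>simp_all add: X_def eval_nat_numeral mixed_form_Fin f_def[symmetric] y_def[symmetric] w_def[symmetric]\<close>)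
    show "has_sphere_deriv (mixed_form a b) (X i) (D i)"
      using c by cases (use nz' a in \<open>simp_all add: X_def D_def mixed_form_deriv_Fin\<close>)
  qed
  moreover have "(\<Prod>i<4. D i) = ((a - 1 / x\<^sup>2) * (a - 1 / z\<^sup>2)) * ((a - 1 / y\<^sup>2) * (a - 1 / w\<^sup>2))"
    by (simp add: D_def eval_nat_numeral)
  ultimately show ?thesis
    using that[of x] nz'(1) pair(3)[OF xz1] pair(3)[OF yw1] xz(1) yw(1)
    by (simp add: X_def)
qed

text \<open>
  For \<open>a = 1\<close> the linear equations of \<open>mixed_form_4_cycle\<close> determine \<open>s\<close> and \<open>s'\<close> from \<open>\<alpha>\<close>, and the
  remaining condition depends only on \<open>\<beta> = \<alpha> - 1 / \<alpha>\<close>, which does not change when \<open>{x, z}\<close> and \<open>{y, w}\<close>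
  are exchanged. It is the cubic equation assumed here, whose roots correspond to the three
  4-cycles; the multiplier is a quadratic polynomial in the root.
\<close>
lemma parabolic_4_cycle:
  assumes n: "b\<^sup>2 = n" "n \<noteq> 0"
    and \<beta>: "\<beta> ^ 3 + 2 * n * \<beta>\<^sup>2 + (3 * n - 3) * \<beta> + 2 = 0"
  obtains u where "u \<noteq> 0" "(mixed_form 1 b ^^ 4) (Fin u) = Fin u"
    "has_sphere_deriv (mixed_form 1 b ^^ 4) (Fin u)
      ((33 - 20 * n) + (2 * n - 6 * n\<^sup>2 - 4) * \<beta> + (2 - 4 * n) * \<beta>\<^sup>2)"
proof -
  have \<beta>0: "\<beta> \<noteq> 0" using \<beta> by auto
  have \<beta>1: "\<beta> - 1 \<noteq> 0"
  proof
    assume "\<beta> - 1 = 0"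
    then have "\<beta> = 1" by simp
    then show False using \<beta> n(2) by simp
  qed
  \<comment> \<open>The number \<open>\<alpha>\<close> is a solution of \<open>\<alpha> - 1 / \<alpha> = \<beta>\<close>.\<close>
  obtain \<alpha> \<alpha>' where "\<alpha> + \<alpha>' = - (- \<beta>)" "\<alpha> * \<alpha>' = - 1" by (rule complex_quadratic_roots)
  then obtain \<gamma> where \<alpha>\<gamma>: "\<alpha> * \<gamma> = 1" "\<alpha> - \<gamma> = \<beta>" by (metis diff_minus_eq_add mult_minus_right minus_minus)
  \<comment> \<open>This is \<open>n / (\<beta> - 1)\<^sup>2\<close>, with \<open>(\<beta> - 1)\<^sup>2\<close> inverted modulo the cubic equation of \<open>\<beta>\<close>.\<close>
  define \<kappa> where "\<kappa> = ((25 * n - 24) + (14 * n + 2) * \<beta> + 7 * \<beta>\<^sup>2) / 25"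
  have "25 * \<kappa> = (25 * n - 24) + (14 * n + 2) * \<beta> + 7 * \<beta>\<^sup>2" by (simp add: \<kappa>_def)
  then have "25 * (\<kappa> * (\<beta> - 1)\<^sup>2) = 25 * n" "25 * (\<kappa> * \<beta> * (2 * \<beta> + 3)) = 25 * (- (\<beta> + 2))"
    using \<beta> by algebra+
  then have \<kappa>: "\<kappa> * (\<beta> - 1)\<^sup>2 = n" "\<kappa> * \<beta> * (2 * \<beta> + 3) = - (\<beta> + 2)" by (simp, algebra)
  define s s' where "s = b * (3 + \<gamma>) / (\<beta> - 1)" and "s' = b * (3 - \<alpha>) / (\<beta> - 1)"
  have ss: "s * (\<beta> - 1) = b * (3 + \<gamma>)" "s' * (\<beta> - 1) = b * (3 - \<alpha>)"
    using \<beta>1 by (simp_all add: s_def s'_def)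
  have s2: "s\<^sup>2 = \<kappa> * (3 + \<gamma>)\<^sup>2" "s'\<^sup>2 = \<kappa> * (3 - \<alpha>)\<^sup>2"
  proof -
    have "(\<beta> - 1)\<^sup>2 * s\<^sup>2 = (\<beta> - 1)\<^sup>2 * (\<kappa> * (3 + \<gamma>)\<^sup>2)"
      "(\<beta> - 1)\<^sup>2 * s'\<^sup>2 = (\<beta> - 1)\<^sup>2 * (\<kappa> * (3 - \<alpha>)\<^sup>2)"
      using ss \<kappa>(1) n(1) by algebra+
    then show "s\<^sup>2 = \<kappa> * (3 + \<gamma>)\<^sup>2" "s'\<^sup>2 = \<kappa> * (3 - \<alpha>)\<^sup>2" using \<beta>1 by simp_all
  qed
  have prod: "(1 - \<alpha>) * (1 + \<gamma>) = - \<beta>" using \<alpha>\<gamma> by algebra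
  have nz: "1 - \<alpha> \<noteq> 0" "1 + \<gamma> \<noteq> 0" using prod \<beta>0 by auto
  have 1: "s' = (2 * 1 - \<alpha>) * s + 2 * b"
  proof -
    have "s' * (\<beta> - 1) = ((2 * 1 - \<alpha>) * s + 2 * b) * (\<beta> - 1)" using ss \<alpha>\<gamma> by algebra
    then show ?thesis using \<beta>1 by simp
  qed
  have 2: "s = (2 * 1 + \<gamma>) * s' + 2 * b"
  proof -
    have "s * (\<beta> - 1) = ((2 * 1 + \<gamma>) * s' + 2 * b) * (\<beta> - 1)" using ss \<alpha>\<gamma> by algebra
    then show ?thesis using \<beta>1 by simp
  qed
  have 3: "s'\<^sup>2 - 4 / (1 + \<gamma>) = \<alpha>\<^sup>2 * (s\<^sup>2 - 4 / (1 - \<alpha>))"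
  proof -
    have inv: "4 / (1 + \<gamma>) * \<beta> = - 4 * (1 - \<alpha>)" "4 / (1 - \<alpha>) * \<beta> = - 4 * (1 + \<gamma>)"
    proof -
      have "\<beta> = - ((1 - \<alpha>) * (1 + \<gamma>))" using prod by simp
      then show "4 / (1 + \<gamma>) * \<beta> = - 4 * (1 - \<alpha>)" "4 / (1 - \<alpha>) * \<beta> = - 4 * (1 + \<gamma>)"
        using nz by simp_all
    qed
    have "(s'\<^sup>2 - 4 / (1 + \<gamma>)) * \<beta> = (\<alpha>\<^sup>2 * (s\<^sup>2 - 4 / (1 - \<alpha>))) * \<beta>"
      using inv s2 \<kappa>(2) \<alpha>\<gamma> by algebra
    then show ?thesis using \<beta>0 by simp
  qed
  obtain u where u: "u \<noteq> 0" "(mixed_form 1 b ^^ 4) (Fin u) = Fin u"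
    "has_sphere_deriv (mixed_form 1 b ^^ 4) (Fin u)
      (((2 * 1 - \<alpha>)\<^sup>2 - 1 * (1 - \<alpha>)\<^sup>2 * s\<^sup>2) * ((2 * 1 + \<gamma>)\<^sup>2 - 1 * (1 + \<gamma>)\<^sup>2 * s'\<^sup>2))"
    using mixed_form_4_cycle[OF _ \<alpha>\<gamma>(1) nz 1 2 3] by auto
  \<comment> \<open>The multiplier is symmetric under exchanging \<open>\<alpha>\<close> and \<open>- \<gamma>\<close>, which exchanges \<open>A\<close> and \<open>B\<close>; hence it is a polynomial in \<open>\<kappa>\<close> and \<open>\<beta> = \<alpha> - \<gamma>\<close>.\<close>
  define A B where "A = (1 - \<alpha>) * (3 + \<gamma>)" and "B = (1 + \<gamma>) * (3 - \<alpha>)"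
  have "((2 * 1 - \<alpha>)\<^sup>2 - 1 * (1 - \<alpha>)\<^sup>2 * s\<^sup>2) * ((2 * 1 + \<gamma>)\<^sup>2 - 1 * (1 + \<gamma>)\<^sup>2 * s'\<^sup>2)
      = ((2 - \<alpha>)\<^sup>2 - \<kappa> * A\<^sup>2) * ((2 + \<gamma>)\<^sup>2 - \<kappa> * B\<^sup>2)"
    unfolding s2 A_def B_def by algebra
  also have "\<dots> = ((2 - \<alpha>) * (2 + \<gamma>))\<^sup>2
      - \<kappa> * (((2 + \<gamma>) * A + (2 - \<alpha>) * B)\<^sup>2 - 2 * ((2 - \<alpha>) * (2 + \<gamma>)) * (A * B)) + \<kappa>\<^sup>2 * (A * B)\<^sup>2"
    by algebra
  also have "(2 - \<alpha>) * (2 + \<gamma>) = 3 - 2 * \<beta>" using \<alpha>\<gamma> by algebra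
  also have "A * B = \<beta> * (3 * \<beta> - 8)" using \<alpha>\<gamma> unfolding A_def B_def by algebra
  also have "(2 + \<gamma>) * A + (2 - \<alpha>) * B = \<beta>\<^sup>2 - 10 * \<beta> + 4"
    using \<alpha>\<gamma> unfolding A_def B_def by algebra
  finally have M: "((2 * 1 - \<alpha>)\<^sup>2 - 1 * (1 - \<alpha>)\<^sup>2 * s\<^sup>2) * ((2 * 1 + \<gamma>)\<^sup>2 - 1 * (1 + \<gamma>)\<^sup>2 * s'\<^sup>2)
      = (3 - 2 * \<beta>)\<^sup>2 - \<kappa> * ((\<beta>\<^sup>2 - 10 * \<beta> + 4)\<^sup>2 - 2 * (3 - 2 * \<beta>) * (\<beta> * (3 * \<beta> - 8)))
        + \<kappa>\<^sup>2 * (\<beta> * (3 * \<beta> - 8))\<^sup>2" .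
  have "625 * ((3 - 2 * \<beta>)\<^sup>2 - \<kappa> * ((\<beta>\<^sup>2 - 10 * \<beta> + 4)\<^sup>2 - 2 * (3 - 2 * \<beta>) * (\<beta> * (3 * \<beta> - 8)))
        + \<kappa>\<^sup>2 * (\<beta> * (3 * \<beta> - 8))\<^sup>2)
    = 625 * ((33 - 20 * n) + (2 * n - 6 * n\<^sup>2 - 4) * \<beta> + (2 - 4 * n) * \<beta>\<^sup>2)"
    using \<beta> \<open>25 * \<kappa> = _\<close> by algebra
  then have "(3 - 2 * \<beta>)\<^sup>2 - \<kappa> * ((\<beta>\<^sup>2 - 10 * \<beta> + 4)\<^sup>2 - 2 * (3 - 2 * \<beta>) * (\<beta> * (3 * \<beta> - 8)))
        + \<kappa>\<^sup>2 * (\<beta> * (3 * \<beta> - 8))\<^sup>2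
    = (33 - 20 * n) + (2 * n - 6 * n\<^sup>2 - 4) * \<beta> + (2 - 4 * n) * \<beta>\<^sup>2"
    by (subst (asm) mult_cancel_left) simp
  then show ?thesis using that u unfolding M by metis
qed

text \<open>
  The analogue of \<open>parabolic_4_cycle\<close> for \<open>a = - 1\<close> and \<open>b\<^sup>2 = 1\<close>, where the condition on \<open>\<beta>\<close> becomes
  \<open>(\<beta> - 2) * (\<beta> + 1)\<^sup>2 = \<beta>\<close>.
\<close>
lemma mixed_form_minus_1_4_cycle:
  assumes b: "b\<^sup>2 = 1" and \<beta>: "\<beta> ^ 3 = 4 * \<beta> + 2"
  obtains u where "u \<noteq> 0" "(mixed_form (- 1) b ^^ 4) (Fin u) = Fin u"
    "has_sphere_deriv (mixed_form (- 1) b ^^ 4) (Fin u) (18 * \<beta>\<^sup>2 - 12 * \<beta> + 5)"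
proof -
  have \<beta>0: "\<beta> \<noteq> 0" using \<beta> by auto
  have \<beta>1: "\<beta> + 1 \<noteq> 0"
  proof
    assume "\<beta> + 1 = 0"
    then have "\<beta> = - 1" by algebra
    then show False using \<beta> by simp
  qed
  obtain \<alpha> \<alpha>' where "\<alpha> + \<alpha>' = - (- \<beta>)" "\<alpha> * \<alpha>' = - 1" by (rule complex_quadratic_roots)
  then obtain \<gamma> where \<alpha>\<gamma>: "\<alpha> * \<gamma> = 1" "\<alpha> - \<gamma> = \<beta>" by (metis diff_minus_eq_add mult_minus_right minus_minus)
  define s s' where "s = b * (1 - \<gamma>) / (\<beta> + 1)" and "s' = b * (1 + \<alpha>) / (\<beta> + 1)"
  have ss: "s * (\<beta> + 1) = b * (1 - \<gamma>)" "s' * (\<beta> + 1) = b * (1 + \<alpha>)"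
    using \<beta>1 by (simp_all add: s_def s'_def)
  have cub: "(\<beta> - 2) * (\<beta> + 1)\<^sup>2 = \<beta>" using \<beta> by algebra
  have s2: "\<beta> * s\<^sup>2 = (\<beta> - 2) * (1 - \<gamma>)\<^sup>2" "\<beta> * s'\<^sup>2 = (\<beta> - 2) * (1 + \<alpha>)\<^sup>2"
  proof -
    have "(\<beta> + 1)\<^sup>2 * (\<beta> * s\<^sup>2) = (\<beta> + 1)\<^sup>2 * ((\<beta> - 2) * (1 - \<gamma>)\<^sup>2)"
      "(\<beta> + 1)\<^sup>2 * (\<beta> * s'\<^sup>2) = (\<beta> + 1)\<^sup>2 * ((\<beta> - 2) * (1 + \<alpha>)\<^sup>2)"
      using ss b cub by algebra+
    then show "\<beta> * s\<^sup>2 = (\<beta> - 2) * (1 - \<gamma>)\<^sup>2" "\<beta> * s'\<^sup>2 = (\<beta> - 2) * (1 + \<alpha>)\<^sup>2"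
      using \<beta>1 by simp_all
  qed
  have prod: "(- 1 - \<alpha>) * (- 1 + \<gamma>) = \<beta>" using \<alpha>\<gamma> by algebra
  have nz: "- 1 - \<alpha> \<noteq> 0" "- 1 + \<gamma> \<noteq> 0" using prod \<beta>0 by auto
  have 1: "s' = (2 * (- 1) - \<alpha>) * s + 2 * b"
  proof -
    have "s' * (\<beta> + 1) = ((2 * (- 1) - \<alpha>) * s + 2 * b) * (\<beta> + 1)" using ss \<alpha>\<gamma> by algebra
    then show ?thesis using \<beta>1 by simp
  qed
  have 2: "s = (2 * (- 1) + \<gamma>) * s' + 2 * b"
  proof -
    have "s * (\<beta> + 1) = ((2 * (- 1) + \<gamma>) * s' + 2 * b) * (\<beta> + 1)" using ss \<alpha>\<gamma> by algebra
    then show ?thesis using \<beta>1 by simp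
  qed
  have 3: "s'\<^sup>2 - 4 / (- 1 + \<gamma>) = \<alpha>\<^sup>2 * (s\<^sup>2 - 4 / (- 1 - \<alpha>))"
  proof -
    have inv: "4 / (- 1 + \<gamma>) * \<beta> = 4 * (- 1 - \<alpha>)" "4 / (- 1 - \<alpha>) * \<beta> = 4 * (- 1 + \<gamma>)"
      unfolding prod[symmetric] using nz by simp_all
    have "(s'\<^sup>2 - 4 / (- 1 + \<gamma>)) * \<beta> = (\<alpha>\<^sup>2 * (s\<^sup>2 - 4 / (- 1 - \<alpha>))) * \<beta>"
      using inv s2 \<alpha>\<gamma> by algebra
    then show ?thesis using \<beta>0 by simp
  qed
  obtain u where u: "u \<noteq> 0" "(mixed_form (- 1) b ^^ 4) (Fin u) = Fin u"
    "has_sphere_deriv (mixed_form (- 1) b ^^ 4) (Fin u)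
      (((2 * (- 1) - \<alpha>)\<^sup>2 - (- 1) * (- 1 - \<alpha>)\<^sup>2 * s\<^sup>2) *
       ((2 * (- 1) + \<gamma>)\<^sup>2 - (- 1) * (- 1 + \<gamma>)\<^sup>2 * s'\<^sup>2))"
    using mixed_form_4_cycle[OF _ \<alpha>\<gamma>(1) nz 1 2 3] by auto
  have "\<beta> * ((- 1 - \<alpha>)\<^sup>2 * s\<^sup>2) = \<beta> * (\<beta> * (\<beta> - 2))" "\<beta> * ((- 1 + \<gamma>)\<^sup>2 * s'\<^sup>2) = \<beta> * (\<beta> * (\<beta> - 2))"
    using s2 \<alpha>\<gamma> by algebra+
  then have e: "(- 1 - \<alpha>)\<^sup>2 * s\<^sup>2 = \<beta> * (\<beta> - 2)" "(- 1 + \<gamma>)\<^sup>2 * s'\<^sup>2 = \<beta> * (\<beta> - 2)"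
    using \<beta>0 by simp_all
  have "((2 * (- 1) - \<alpha>)\<^sup>2 - (- 1) * (- 1 - \<alpha>)\<^sup>2 * s\<^sup>2) *
       ((2 * (- 1) + \<gamma>)\<^sup>2 - (- 1) * (- 1 + \<gamma>)\<^sup>2 * s'\<^sup>2) = 18 * \<beta>\<^sup>2 - 12 * \<beta> + 5"
    using e \<alpha>\<gamma> \<beta> by algebra
  then show ?thesis using that u by metis
qed

section \<open>Excluding irrational multipliers\<close>

lemma int_square_strictly_between:
  fixes a k :: int
  assumes "0 \<le> a" "a\<^sup>2 < k\<^sup>2" "k\<^sup>2 < (a + 1)\<^sup>2"
  shows False
proof -
  have "a < \<bar>k\<bar>" by (rule power2_less_imp_less) (use assms in auto)
  moreover have "\<bar>k\<bar> < a + 1" by (rule power2_less_imp_less) (use assms in auto)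
  ultimately show False by simp
qed

lemma int_cubic_no_root:
  fixes m p A B C :: int
  assumes "p > 0" "\<forall>r\<in>set [0..p - 1]. (r ^ 3 + A * r\<^sup>2 + B * r + C) mod p \<noteq> 0"
  shows "m ^ 3 + A * m\<^sup>2 + B * m + C \<noteq> 0"
proof
  assume 0: "m ^ 3 + A * m\<^sup>2 + B * m + C = 0"
  define r where "r = m mod p"
  have "[r = m] (mod p)" by (simp add: r_def cong_def)
  then have "[r ^ 3 + A * r\<^sup>2 + B * r + C = m ^ 3 + A * m\<^sup>2 + B * m + C] (mod p)"
    by (intro cong_add cong_mult cong_pow cong_refl)
  then have "(r ^ 3 + A * r\<^sup>2 + B * r + C) mod p = 0" using 0 by (simp add: cong_def)
  moreover have r: "r \<in> set [0..p - 1]" using assms(1) by (simp add: r_def)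
  have "(r ^ 3 + A * r\<^sup>2 + B * r + C) mod p \<noteq> 0" by (rule bspec[OF assms(2) r])
  ultimately show False by contradiction
qed

lemma complex_cubic_not_Ints:
  fixes M :: complex and A B C p :: int
  assumes "p > 0" "\<forall>r\<in>set [0..p - 1]. (r ^ 3 + A * r\<^sup>2 + B * r + C) mod p \<noteq> 0"
    and "M ^ 3 + of_int A * M\<^sup>2 + of_int B * M + of_int C = 0"
  shows "M \<notin> \<int>"
proof
  assume "M \<in> \<int>"
  then obtain m where m: "M = of_int m" by (rule Ints_cases)
  have "of_int (m ^ 3 + A * m\<^sup>2 + B * m + C) = (0 :: complex)" using assms(3) by (simp add: m)
  then have "m ^ 3 + A * m\<^sup>2 + B * m + C = 0" by (simp only: of_int_eq_0_iff)
  then show False using int_cubic_no_root[OF assms(1,2)] by blast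
qed

lemma integral_4_cycle:
  assumes "integral_periods g" "(g ^^ 4) x = x" "has_sphere_deriv (g ^^ 4) x M"
  shows "M \<in> \<int>"
  using assms unfolding integral_periods_def by (meson one_le_numeral)

text \<open>
  Here \<open>M = - 40 \<plusminus> 3 * \<surd>41\<close>; its square is irrational as well, because \<open>2361600\<close> lies strictly
  between \<open>1536\<^sup>2\<close> and \<open>1537\<^sup>2\<close>.
\<close>
lemma square_not_Ints_if_quadratic:
  fixes M :: complex
  assumes "(M + 40)\<^sup>2 = 369"
  shows "M\<^sup>2 \<notin> \<int>"
proof
  assume "M\<^sup>2 \<in> \<int>"
  then obtain i where i: "M\<^sup>2 = of_int i" by (rule Ints_cases)
  have e: "M\<^sup>2 - 1969 = ((M + 40)\<^sup>2 - 369) - 80 * (M + 40)"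
    by (simp add: power2_eq_square algebra_simps)
  have "(M\<^sup>2 - 1969)\<^sup>2 = (- (80 * (M + 40)))\<^sup>2" unfolding e assms by simp
  also have "\<dots> = 6400 * (M + 40)\<^sup>2" by (simp only: power2_minus power_mult_distrib) simp
  finally have "(M\<^sup>2 - 1969)\<^sup>2 = 2361600" unfolding assms by simp
  then have "of_int ((i - 1969)\<^sup>2) = (of_int 2361600 :: complex)" by (simp add: i)
  then have "(i - 1969)\<^sup>2 = 2361600" by (simp only: of_int_eq_iff)
  then show False using int_square_strictly_between[of 1536 "i - 1969"] by simp
qed

lemma parabolic_4_cycle_at_4:
  assumes b: "b\<^sup>2 = 4"
  obtains u M where "u \<noteq> 0" "(mixed_form 1 b ^^ 4) (Fin u) = Fin u"
    "has_sphere_deriv (mixed_form 1 b ^^ 4) (Fin u) M" "(M + 40)\<^sup>2 = 369"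
proof -
  obtain \<beta> \<beta>' :: complex where "\<beta> + \<beta>' = - 7" "\<beta> * \<beta>' = 2" by (rule complex_quadratic_roots)
  then have \<beta>: "\<beta>\<^sup>2 + 7 * \<beta> + 2 = 0" by algebra
  then have "\<beta> ^ 3 + 2 * 4 * \<beta>\<^sup>2 + (3 * 4 - 3) * \<beta> + 2 = 0" by algebra
  from parabolic_4_cycle[OF b _ this] obtain u where u: "u \<noteq> 0"
      "(mixed_form 1 b ^^ 4) (Fin u) = Fin u"
      "has_sphere_deriv (mixed_form 1 b ^^ 4) (Fin u)
        ((33 - 20 * 4) + (2 * 4 - 6 * 4\<^sup>2 - 4) * \<beta> + (2 - 4 * 4) * \<beta>\<^sup>2)"
    by auto
  moreover have "((33 - 20 * 4) + (2 * 4 - 6 * 4\<^sup>2 - 4) * \<beta> + (2 - 4 * 4) * \<beta>\<^sup>2 + 40)\<^sup>2 = 369"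
    using \<beta> by algebra
  ultimately show ?thesis using that by blast
qed

text \<open>
  Squaring semiconjugates the odd map \<open>f z = a * z + 1 / z\<close> to \<open>h u = u + 2 * a + 1 / u\<close>, one of the maps treated in
  \<open>parabolic_4_cycle_at_4\<close>. If \<open>z\<^sup>2 = u\<close> lies on a 4-cycle of \<open>h\<close>, then four steps of \<open>f\<close> take \<open>z\<close> to \<open>z\<close> or
  \<open>- z\<close>, and by oddness eight steps take it back to \<open>z\<close>. So \<open>f\<close> has the multiplier \<open>M\<^sup>2\<close> whenever \<open>h\<close>
  has \<open>M\<close>, and \<open>M\<^sup>2\<close> can be irrational.
\<close>
lemma odd_mixed_form_not_integral:
  assumes a: "a\<^sup>2 = 1"
  shows "\<not> integral_periods (mixed_form a 0)"
proof
  assume int: "integral_periods (mixed_form a 0)"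
  have a0: "a \<noteq> 0" using a by auto
  let ?f = "mixed_form a 0" and ?h = "mixed_form 1 (2 * a)"
  define neg where "neg x = (case x of Fin z \<Rightarrow> Fin (- z) | Infty \<Rightarrow> Infty)" for x
  have neg: "neg \<circ> ?f = ?f \<circ> neg"
  proof
    fix x
    show "(neg \<circ> ?f) x = (?f \<circ> neg) x"
      by (cases x) (auto simp: neg_def mixed_form_def)
  qed
  have semi: "quad_poly 0 \<circ> ?f = ?h \<circ> quad_poly 0"
  proof
    fix x
    show "(quad_poly 0 \<circ> ?f) x = (?h \<circ> quad_poly 0) x"
    proof (cases x)
      case (Fin z)
      have "(a * z + 1 / z)\<^sup>2 = z\<^sup>2 + 2 * a + 1 / z\<^sup>2" if "z \<noteq> 0"
      proof -
        have "(a * z + 1 / z)\<^sup>2 = a\<^sup>2 * z\<^sup>2 + 2 * a * (z * (1 / z)) + (1 / z)\<^sup>2" by algebra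
        then show ?thesis using that a by (simp add: power_one_over)
      qed
      then show ?thesis by (auto simp: Fin quad_poly_def mixed_form_def)
    qed (simp add: quad_poly_def mixed_form_def)
  qed
  have "(2 * a)\<^sup>2 = 4" using a by algebra
  then obtain u M where u: "u \<noteq> 0" "(?h ^^ 4) (Fin u) = Fin u"
      "has_sphere_deriv (?h ^^ 4) (Fin u) M" "(M + 40)\<^sup>2 = 369"
    by (rule parabolic_4_cycle_at_4)
  define z where "z = csqrt u"
  have z: "z\<^sup>2 = u" "z \<noteq> 0" using u(1) by (auto simp: z_def)
  have "quad_poly 0 ((?f ^^ 4) (Fin z)) = Fin u"
    using fun_cong[OF semiconjugate_funpow[OF semi, of 4], of "Fin z"] u(2) z
    by (simp add: quad_poly_def)
  then obtain w where w: "(?f ^^ 4) (Fin z) = Fin w" "w\<^sup>2 = z\<^sup>2"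
    using z by (auto simp: quad_poly_def split: riemann_sphere.splits)
  have "(?f ^^ 4) ((?f ^^ 4) (Fin z)) = Fin z"
  proof (cases "w = z")
    case True
    then show ?thesis using w by simp
  next
    case False
    then have "w = - z" using w(2) by (simp add: power2_eq_iff)
    then have *: "(?f ^^ 4) (Fin z) = neg (Fin z)" using w by (simp add: neg_def)
    have "(?f ^^ 4) (neg (Fin z)) = neg ((?f ^^ 4) (Fin z))"
      using fun_cong[OF semiconjugate_funpow[OF neg, of 4], of "Fin z"] by simp
    also have "\<dots> = Fin z" unfolding * by (simp add: neg_def)
    finally show ?thesis using * by simp
  qed
  then have per: "(?f ^^ 8) (Fin z) = Fin z"
    using funpow_add[of 4 4 ?f] by simp
  obtain D where D: "has_sphere_deriv (?f ^^ 8) (Fin z) D"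
    using sphere_differentiable_funpow[OF sphere_differentiable_if_quadratic[OF quadratic_mixed_form[OF a0]]] by blast
  have "has_sphere_deriv ((?h ^^ 4) ^^ 2) (Fin u) (M ^ 2)"
    by (rule has_sphere_deriv_fixed_funpow[OF u(3,2)])
  then have "has_sphere_deriv (?h ^^ 8) (quad_poly 0 (Fin z)) (M\<^sup>2)"
    using z by (simp add: funpow_mult quad_poly_def)
  from semiconjugate_multiplier[OF semi quad_poly_deriv_Fin _ per D this]
  have "D = M\<^sup>2" using z by simp
  moreover have "D \<in> \<int>" using int per D unfolding integral_periods_def by (meson one_le_numeral)
  ultimately show False using square_not_Ints_if_quadratic[OF u(4)] by simp
qed

text \<open>
  The finite fixed points are best parametrised by their reciprocals \<open>r\<close>, which are the roots of
  a monic quadratic polynomial.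
\<close>
lemma mixed_form_fixed_point:
  assumes "a \<noteq> 0" "r \<noteq> 0" "r\<^sup>2 + b * r + (a - 1) = 0"
  shows "mixed_form a b (Fin (1 / r)) = Fin (1 / r)"
    and "has_sphere_deriv (mixed_form a b) (Fin (1 / r)) (a - r\<^sup>2)"
proof -
  have "a + b * r + r\<^sup>2 = 1" using assms(3) by algebra
  then have "a * (1 / r) + b + 1 / (1 / r) = 1 / r"
    using assms(2) by (simp add: field_simps power2_eq_square)
  then show "mixed_form a b (Fin (1 / r)) = Fin (1 / r)" using assms(2) by (simp add: mixed_form_Fin)
  show "has_sphere_deriv (mixed_form a b) (Fin (1 / r)) (a - r\<^sup>2)"
    using mixed_form_deriv_Fin[of a "1 / r" b] assms by (simp add: power_one_over)
qed

text \<open>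
  The equation says \<open>(w - 2 * n\<^sup>2)\<^sup>2 = (2 * n)\<^sup>2 * (n * (n - 3))\<close>, so for \<open>n \<noteq> 0\<close> the number \<open>n * (n - 3)\<close> is a square. But
  it lies strictly between consecutive squares if \<open>n \<ge> 5\<close> or \<open>n \<le> - 2\<close>, and it is negative at \<open>1\<close>
  and \<open>2\<close>.
\<close>
lemma parabolic_3_cycle_solutions:
  fixes n w :: int
  assumes "w\<^sup>2 - 4 * n\<^sup>2 * w + 12 * n ^ 3 = 0"
  shows "n \<in> {- 1, 0, 3, 4}"
proof (cases "n = 0")
  case False
  have e: "(w - 2 * n\<^sup>2)\<^sup>2 = (2 * n)\<^sup>2 * (n * (n - 3))" using assms by algebra
  then have "(2 * n)\<^sup>2 dvd (w - 2 * n\<^sup>2)\<^sup>2" by simp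
  then have "2 * n dvd w - 2 * n\<^sup>2" by (simp only: pow_divides_pow_iff)
  then obtain j where "w - 2 * n\<^sup>2 = 2 * n * j" by (rule dvdE)
  then have "(2 * n)\<^sup>2 * j\<^sup>2 = (2 * n)\<^sup>2 * (n * (n - 3))" using e by (simp add: power_mult_distrib)
  then have j: "j\<^sup>2 = n * (n - 3)" using False by simp
  have "\<not> n \<ge> 5"
  proof
    assume "n \<ge> 5"
    then have "(n - 2)\<^sup>2 < j\<^sup>2" "j\<^sup>2 < (n - 2 + 1)\<^sup>2"
      unfolding j by (simp_all add: power2_eq_square algebra_simps)
    then show False using int_square_strictly_between[of "n - 2" j] \<open>n \<ge> 5\<close> by simp
  qed
  moreover have "\<not> n \<le> - 2"
  proof
    assume "n \<le> - 2"
    then have "(1 - n)\<^sup>2 < j\<^sup>2" "j\<^sup>2 < (1 - n + 1)\<^sup>2"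
      unfolding j by (simp_all add: power2_eq_square algebra_simps)
    then show False using int_square_strictly_between[of "1 - n" j] \<open>n \<le> - 2\<close> by simp
  qed
  moreover have "n * (n - 3) \<ge> 0" unfolding j[symmetric] by simp
  then have "n \<noteq> 1" "n \<noteq> 2" by auto
  ultimately show ?thesis using False by auto
qed simp

lemma parabolic_4_cycle_integral:
  assumes "integral_periods (mixed_form 1 b)" "b\<^sup>2 = n" "n \<noteq> 0"
    and "\<beta> ^ 3 + 2 * n * \<beta>\<^sup>2 + (3 * n - 3) * \<beta> + 2 = 0"
  shows "(33 - 20 * n) + (2 * n - 6 * n\<^sup>2 - 4) * \<beta> + (2 - 4 * n) * \<beta>\<^sup>2 \<in> \<int>"
  by (rule parabolic_4_cycle[OF assms(2-4)]) (rule integral_4_cycle[OF assms(1)])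

text \<open>
  If \<open>b \<noteq> 0\<close>, there is one finite fixed point, with multiplier \<open>1 - b\<^sup>2\<close>; so \<open>n = b\<^sup>2\<close> is an integer. The 3-cycles
  leave only four values of \<open>n\<close>. For these the 3-cycles do have integer multipliers, but
  the 4-cycles (for \<open>n = 0\<close>, the points of period eight) do not.
\<close>
lemma parabolic_not_integral: "\<not> integral_periods (mixed_form 1 b)"
proof
  assume int: "integral_periods (mixed_form 1 b)"
  have "b\<^sup>2 \<in> \<int>"
  proof (cases "b = 0")
    case False
    have "(- b)\<^sup>2 + b * (- b) + (1 - 1) = 0" by (simp add: power2_eq_square)
    from mixed_form_fixed_point[OF _ _ this] have "1 - (- b)\<^sup>2 \<in> \<int>"
      using integral_fixed_point[OF int] False by simp
    then have "1 - (1 - b\<^sup>2) \<in> \<int>" by (intro Ints_diff) auto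
    then show ?thesis by simp
  qed simp
  then obtain n where n: "b\<^sup>2 = of_int n" by (rule Ints_cases)
  obtain t t' where "t + t' = - (2 * b)" "t * t' = 3" by (rule complex_quadratic_roots)
  then have t: "t\<^sup>2 + 2 * b * t + 3 = 0" by algebra
  then have t0: "t \<noteq> 0" by auto
  obtain M where M: "M \<in> \<int>" "(M - 19 + 12 * b\<^sup>2) * t = - 6 * b ^ 3"
    using parabolic_3_cycle[OF int t] .
  have "M - 19 + 12 * b\<^sup>2 \<in> \<int>" using M(1) n by (intro Ints_add Ints_diff Ints_mult) auto
  then obtain w where w: "M - 19 + 12 * b\<^sup>2 = of_int w" by (rule Ints_cases)
  have wt: "of_int w * t = - 6 * b ^ 3" using M(2) unfolding w .
  have "t\<^sup>2 * ((of_int w)\<^sup>2 - 4 * (b\<^sup>2)\<^sup>2 * of_int w + 12 * (b\<^sup>2) ^ 3) = 0" using wt t by algebra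
  then have "(of_int w)\<^sup>2 - 4 * (b\<^sup>2)\<^sup>2 * of_int w + 12 * (b\<^sup>2) ^ 3 = 0" using t0 by simp
  then have "of_int (w\<^sup>2 - 4 * n\<^sup>2 * w + 12 * n ^ 3) = (0 :: complex)" unfolding n by simp
  then have "w\<^sup>2 - 4 * n\<^sup>2 * w + 12 * n ^ 3 = 0" by (simp only: of_int_eq_0_iff)
  then have "n \<in> {- 1, 0, 3, 4}" by (rule parabolic_3_cycle_solutions)
  then consider "n = - 1" | "n = 0" | "n = 3" | "n = 4" by auto
  then show False
  proof cases
    case 1
    then have b: "b\<^sup>2 = - 1" using n by simp
    obtain \<beta> :: complex where "1 * \<beta> ^ 3 + (- 2) * \<beta>\<^sup>2 + (- 6) * \<beta> + 2 = 0"
      by (rule complex_cubic_root[of 1]) simp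
    then have \<beta>: "\<beta> ^ 3 + 2 * (- 1) * \<beta>\<^sup>2 + (3 * (- 1) - 3) * \<beta> + 2 = 0" by simp
    define M where "M = (33 - 20 * (- 1)) + (2 * (- 1) - 6 * (- 1)\<^sup>2 - 4) * \<beta> + (2 - 4 * (- 1)) * \<beta>\<^sup>2"
    have "M \<in> \<int>"
      unfolding M_def by (rule parabolic_4_cycle_integral[OF int b _ \<beta>]) simp
    \<comment> \<open>The characteristic polynomial of \<open>M\<close> over the rationals; it has no root modulo \<open>17\<close>.\<close>
    moreover have "M ^ 3 + of_int (- 231) * M\<^sup>2 + of_int 17211 * M + of_int (- 407861) = 0"
      using \<beta> unfolding M_def by (simp, algebra)
    then have "M \<notin> \<int>" by (rule complex_cubic_not_Ints[of 17, rotated 2]) (simp, code_simp)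
    ultimately show False by blast
  next
    case 2
    then show False using odd_mixed_form_not_integral[of 1] int n by simp
  next
    case 3
    then have b: "b\<^sup>2 = 3" using n by simp
    obtain \<beta> :: complex where "1 * \<beta> ^ 3 + 6 * \<beta>\<^sup>2 + 6 * \<beta> + 2 = 0"
      by (rule complex_cubic_root[of 1]) simp
    then have \<beta>: "\<beta> ^ 3 + 2 * 3 * \<beta>\<^sup>2 + (3 * 3 - 3) * \<beta> + 2 = 0" by simp
    define M where "M = (33 - 20 * 3) + (2 * 3 - 6 * 3\<^sup>2 - 4) * \<beta> + (2 - 4 * 3) * \<beta>\<^sup>2"
    have "M \<in> \<int>"
      unfolding M_def by (rule parabolic_4_cycle_integral[OF int b _ \<beta>]) simp
    \<comment> \<open>Again the characteristic polynomial, now without roots modulo \<open>7\<close>.\<close>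
    moreover have "M ^ 3 + of_int 9 * M\<^sup>2 + of_int 123 * M + of_int 1307 = 0"
      using \<beta> unfolding M_def by (simp, algebra)
    then have "M \<notin> \<int>" by (rule complex_cubic_not_Ints[of 7, rotated 2]) (simp, code_simp)
    ultimately show False by blast
  next
    case 4
    then have "b\<^sup>2 = 4" using n by simp
    then obtain u M where "(mixed_form 1 b ^^ 4) (Fin u) = Fin u"
        "has_sphere_deriv (mixed_form 1 b ^^ 4) (Fin u) M" and M: "(M + 40)\<^sup>2 = 369"
      by (rule parabolic_4_cycle_at_4)
    then have "M \<in> \<int>" using integral_4_cycle[OF int] by blast
    then have "M\<^sup>2 \<in> \<int>" by simp
    then show False using square_not_Ints_if_quadratic[OF M] by blast
  qed
qed

lemma mixed_form_minus_1_not_integral: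
  assumes "b\<^sup>2 = 1"
  shows "\<not> integral_periods (mixed_form (- 1) b)"
proof
  assume int: "integral_periods (mixed_form (- 1) b)"
  obtain \<beta> :: complex where "1 * \<beta> ^ 3 + 0 * \<beta>\<^sup>2 + (- 4) * \<beta> + (- 2) = 0"
    by (rule complex_cubic_root[of 1]) simp
  then have \<beta>: "\<beta> ^ 3 = 4 * \<beta> + 2" by algebra
  define M where "M = 18 * \<beta>\<^sup>2 - 12 * \<beta> + 5"
  have "M \<in> \<int>"
    unfolding M_def
    by (rule mixed_form_minus_1_4_cycle[OF assms \<beta>]) (rule integral_4_cycle[OF int])
  \<comment> \<open>The characteristic polynomial of \<open>M\<close> over the rationals; it has no root modulo \<open>7\<close>.\<close>
  moreover have "M ^ 3 + of_int (- 159) * M\<^sup>2 + of_int 7419 * M + of_int (- 84221) = 0"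
    using \<beta> unfolding M_def by (simp, algebra)
  then have "M \<notin> \<int>" by (rule complex_cubic_not_Ints[of 7, rotated 2]) (simp, code_simp)
  ultimately show False by blast
qed

text \<open>
  With \<open>2 * x = l + 1\<close> the multiplier of a fixed point, \<open>k = 4 * c = 1 - l\<^sup>2\<close> is an integer. Integrality at
  the 3-cycles makes \<open>l\<^sup>2 - 8\<close> a square unless \<open>k = 0\<close>, which forces \<open>l\<^sup>2 = 9\<close>.
\<close>
lemma quad_poly_integral:
  assumes int: "integral_periods (quad_poly c)"
  shows "c = 0 \<or> c = - 2"
proof -
  obtain x y where "x + y = - (- 1)" "x * y = c" by (rule complex_quadratic_roots)
  then have xy: "x + y = 1" "x * y = c" by simp_all
  then have "x\<^sup>2 + c = x" by algebra
  then have "2 * x \<in> \<int>"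
    using integral_fixed_point[OF int, of "Fin x"] quad_poly_deriv_Fin by (simp add: quad_poly_def)
  then have "2 * x - 1 \<in> \<int>" by (intro Ints_diff) auto
  then obtain l where l: "2 * x - 1 = of_int l" by (rule Ints_cases)
  have c: "4 * c = 1 - (of_int l)\<^sup>2" unfolding l[symmetric] using xy by algebra
  define k where "k = 1 - l\<^sup>2"
  have ck: "4 * c = of_int k" using c by (simp add: k_def)
  obtain s s' where "s + s' = - 1" "s * s' = c + 2" by (rule complex_quadratic_roots)
  then have s: "s\<^sup>2 + s + c + 2 = 0" by algebra
  have "8 * (c * s + c + 1) \<in> \<int>" by (rule quad_poly_3_cycle[OF int s])
  then obtain m where m: "8 * (c * s + c + 1) = of_int m" by (rule Ints_cases)
  define w where "w = m - 2 * k - 8"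
  have w: "of_int w = 8 * c * s" 
    unfolding w_def of_int_diff of_int_mult of_int_numeral m[symmetric] ck[symmetric]
    by (simp add: algebra_simps)
  have "(of_int w + 4 * c)\<^sup>2 = - (4 * c)\<^sup>2 * (4 * c + 7)" using w s by algebra
  then have "of_int ((w + k)\<^sup>2) = (of_int (- (k\<^sup>2) * (k + 7)) :: complex)" unfolding ck by simp
  then have wk: "(w + k)\<^sup>2 = k\<^sup>2 * (l\<^sup>2 - 8)" unfolding of_int_eq_iff by (simp add: k_def algebra_simps)
  show ?thesis
  proof (cases "k = 0")
    case True
    then show ?thesis using ck by simp
  next
    case False
    have "k\<^sup>2 dvd (w + k)\<^sup>2" using wk by simp
    then have "k dvd w + k" by (simp only: pow_divides_pow_iff)
    then obtain j where "w + k = k * j" by (rule dvdE)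
    then have "k\<^sup>2 * j\<^sup>2 = k\<^sup>2 * (l\<^sup>2 - 8)" using wk by (simp add: power_mult_distrib)
    then have j: "j\<^sup>2 = \<bar>l\<bar>\<^sup>2 - 8" using False by simp
    have "\<not> \<bar>l\<bar> \<ge> 5"
    proof
      assume "\<bar>l\<bar> \<ge> 5"
      then have "(\<bar>l\<bar> - 1)\<^sup>2 < \<bar>l\<bar>\<^sup>2 - 8" "\<bar>l\<bar>\<^sup>2 - 8 < (\<bar>l\<bar> - 1 + 1)\<^sup>2"
        by (simp_all add: power2_eq_square algebra_simps)
      moreover have "0 \<le> \<bar>l\<bar> - 1" using \<open>\<bar>l\<bar> \<ge> 5\<close> by simp
      ultimately show False
        unfolding j[symmetric] by (intro int_square_strictly_between[of "\<bar>l\<bar> - 1" j])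
    qed
    then consider "\<bar>l\<bar> = 0" | "\<bar>l\<bar> = 1" | "\<bar>l\<bar> = 2" | "\<bar>l\<bar> = 3" | "\<bar>l\<bar> = 4" by linarith
    then have "\<bar>l\<bar> = 3"
    proof cases
      case 5
      then have "j\<^sup>2 = 8" using j by simp
      then show ?thesis using int_square_strictly_between[of 2 j] by simp
    qed (use j zero_le_power2[of j] in auto)
    then have "l\<^sup>2 = 9" using power2_abs[of l] by simp
    then have "of_int (l\<^sup>2) = (9 :: complex)" by simp
    then have "4 * c = 4 * (- 2)" using c by simp
    then show ?thesis by simp
  qed
qed

section \<open>Fixed points and the classification\<close>

text \<open>
  This is \<open>1 / A + 1 / B + 1 / C = 1\<close>, where no summand exceeds \<open>1 / 3\<close>.
\<close>
lemma unit_fraction_triple: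
  fixes A B C :: int
  assumes eq: "A * B + A * C + B * C = A * B * C"
    and ne: "A \<notin> {0, 1, 2}" "B \<notin> {0, 1, 2}" "C \<notin> {0, 1, 2}"
  shows "A = 3 \<and> B = 3 \<and> C = 3"
proof -
  have le: "1 / real_of_int X \<le> 1 / 3 \<and> (1 / real_of_int X = 1 / 3 \<longrightarrow> X = 3)"
    if X: "X \<notin> {0, 1, 2}" for X
  proof (cases "X < 0")
    case True
    then have "1 / real_of_int X < 0" by simp
    then show ?thesis by linarith
  next
    case False
    then have "X \<ge> 3" using X by auto
    then show ?thesis by (auto simp: field_simps)
  qed
  have "1 / real_of_int A + 1 / real_of_int B + 1 / real_of_int C = 1"
  proof -
    have "real_of_int (A * B + A * C + B * C) = real_of_int (A * B * C)" using eq by simp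
    then show ?thesis using ne by (simp add: field_simps)
  qed
  then show ?thesis using le[OF ne(1)] le[OF ne(2)] le[OF ne(3)] by linarith
qed

text \<open>
  These are the quadratic power maps and Chebyshev maps: \<open>- T\<^sub>2 z = 2 - z\<^sup>2\<close> is conjugate to \<open>T\<^sub>2\<close> by
  \<open>z \<mapsto> - z\<close>, so three models are enough.
\<close>
definition exceptional :: "(riemann_sphere \<Rightarrow> riemann_sphere) \<Rightarrow> bool" where
  "exceptional g \<longleftrightarrow> conjugate_maps g (quad_poly 0) \<or> conjugate_maps g (quad_poly (- 2)) \<or>
     conjugate_maps g (rat_fun 1 (monom 1 2))"

lemma exceptional_conjugate: "conjugate_maps g h \<Longrightarrow> exceptional h \<Longrightarrow> exceptional g"
  unfolding exceptional_def using conjugate_maps_trans by blast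

lemma exceptional_if_superattracting_fixed:
  assumes "quadratic g" "integral_periods g" "g x = x" "has_sphere_deriv g x 0"
  shows "exceptional g"
proof -
  obtain c where c: "conjugate_maps g (quad_poly c)" using normal_form(1)[OF assms(1,3,4)] by blast
  then have "integral_periods (quad_poly c)"
    using integral_periods_conjugate assms(2) sphere_differentiable_if_quadratic[OF assms(1)] by blast
  then show ?thesis using quad_poly_integral c unfolding exceptional_def by blast
qed

lemma no_parabolic_fixed:
  assumes "quadratic g" "integral_periods g" "g x = x"
  shows "\<not> has_sphere_deriv g x 1"
proof
  assume "has_sphere_deriv g x 1"
  then obtain b where "conjugate_maps g (mixed_form 1 b)"
    using normal_form(2)[OF assms(1,3)] by fastforce
  then have "integral_periods (mixed_form 1 b)"
    using integral_periods_conjugate assms(2) sphere_differentiable_if_quadratic[OF assms(1)] by blast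
  then show False using parabolic_not_integral by blast
qed

text \<open>
  If \<open>k1\<close> and \<open>k2\<close> are the squares of the reciprocals of the two finite fixed points, then
  \<open>k1 * k2 = 4\<close> and \<open>b\<^sup>2 = k1 + k2 - 4\<close>. So \<open>b\<^sup>2\<close> is \<open>0\<close> or \<open>1\<close>, unless one of the finite fixed points has
  multiplier \<open>0\<close> or \<open>1\<close>.
\<close>
lemma exceptional_if_fixed_minus_1:
  assumes "quadratic g" "integral_periods g" "g x = x" "has_sphere_deriv g x (- 1)"
  shows "exceptional g"
proof -
  obtain b where conj: "conjugate_maps g (mixed_form (- 1) b)"
    using normal_form(2)[OF assms(1,3,4)] by auto
  let ?h = "mixed_form (- 1) b"
  have int: "integral_periods ?h"
    using integral_periods_conjugate[OF conj assms(2)] sphere_differentiable_if_quadratic[OF assms(1)] .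
  have quad: "quadratic ?h" by (rule quadratic_mixed_form) simp
  obtain r1 r2 where r: "r1 + r2 = - b" "r1 * r2 = - 1 - 1" by (rule complex_quadratic_roots)
  have eq: "r1\<^sup>2 + b * r1 + (- 1 - 1) = 0" "r2\<^sup>2 + b * r2 + (- 1 - 1) = 0"
    using r by algebra+
  have r0: "r1 \<noteq> 0" "r2 \<noteq> 0" using r by auto
  note F1 = mixed_form_fixed_point[OF _ r0(1) eq(1)] and F2 = mixed_form_fixed_point[OF _ r0(2) eq(2)]
  have "- 1 - r1\<^sup>2 \<in> \<int>" "- 1 - r2\<^sup>2 \<in> \<int>" using integral_fixed_point[OF int] F1 F2 by auto
  then obtain n1 n2 where n: "- 1 - r1\<^sup>2 = of_int n1" "- 1 - r2\<^sup>2 = of_int n2"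
    by (elim Ints_cases) metis
  show ?thesis
  proof (cases "n1 = 0 \<or> n2 = 0")
    case True
    then have "exceptional ?h"
      using exceptional_if_superattracting_fixed[OF quad int] F1 F2 n by auto
    then show ?thesis using exceptional_conjugate[OF conj] by blast
  next
    case False
    have ne1: "n1 \<noteq> 1" "n2 \<noteq> 1" using no_parabolic_fixed[OF quad int] F1 F2 n by auto
    define k1 k2 where "k1 = - 1 - n1" and "k2 = - 1 - n2"
    have k: "r1\<^sup>2 = of_int k1" "r2\<^sup>2 = of_int k2" using n by (auto simp: k1_def k2_def algebra_simps)
    have "r1\<^sup>2 * r2\<^sup>2 = 4" using r(2) by algebra
    then have "of_int (k1 * k2) = (of_int 4 :: complex)" unfolding k by simp
    then have k12: "k1 * k2 = 4" by (simp only: of_int_eq_iff)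
    have b2: "b\<^sup>2 = of_int (k1 + k2 - 4)"
    proof -
      have "b\<^sup>2 = r1\<^sup>2 + r2\<^sup>2 - 4" using r by algebra
      then show ?thesis unfolding k by simp
    qed
    have kne: "k1 \<noteq> - 1" "k1 \<noteq> - 2" "k2 \<noteq> - 1" "k2 \<noteq> - 2"
      using False ne1 by (auto simp: k1_def k2_def)
    have "k1 dvd 4" using k12 by (metis dvd_triv_left)
    then have "\<bar>k1\<bar> \<le> 4" using dvd_imp_le_int[of 4 k1] by simp
    then have "k1 \<in> {- 4, - 3, - 2, - 1, 0, 1, 2, 3, 4}" by auto
    then have "k1 + k2 - 4 = 0 \<or> k1 + k2 - 4 = 1" using k12 kne by auto
    then have "b\<^sup>2 = of_int 0 \<or> b\<^sup>2 = of_int 1" using b2 by metis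
    then have "b = 0 \<or> b\<^sup>2 = 1" by simp
    then have False
      using odd_mixed_form_not_integral[of "- 1"] mixed_form_minus_1_not_integral[of b] int by auto
    then show ?thesis ..
  qed
qed

text \<open>
  The map \<open>- z / 2 + 1 / z\<close> exchanges its critical points \<open>c\<close> and \<open>- c\<close>, where \<open>c\<^sup>2 = - 2\<close>. The conjugacy
  moves them to \<open>0\<close> and infinity.
\<close>
lemma mixed_form_conjugate_inverse_square:
  "conjugate_maps (mixed_form (- 1 / 2) 0) (rat_fun 1 (monom 1 2))"
proof -
  define c where "c = csqrt (- 2)"
  have c2: "c\<^sup>2 = - 2" unfolding c_def by (rule power2_csqrt)
  have det: "1 * c - (- c) * 1 \<noteq> 0" using c2 by auto
  define \<phi> where "\<phi> = rat_fun [:- c, 1:] [:c, 1:]"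
  have lift\<phi>: "lifts \<phi> (\<lambda>u v. 1 * u + (- c) * v) (\<lambda>u v. 1 * u + c * v)"
    unfolding \<phi>_def by (rule lifts_rat_fun_linear[OF det])
  have lift_target: "lifts (rat_fun 1 (monom 1 2)) (qform 0 0 1) (qform 1 0 0)"
  proof (rule liftsI)
    fix u v :: complex
    assume "u \<noteq> 0 \<or> v \<noteq> 0"
    then show "rat_fun 1 (monom 1 2) (sph u v) = sph (qform 0 0 1 u v) (qform 1 0 0 u v)"
      by (auto simp: sph_def rat_fun_def qform_def poly_monom degree_monom_eq power_divide)
  qed (auto simp: qform_def)
  have "\<phi> \<circ> mixed_form (- 1 / 2) 0 = rat_fun 1 (monom 1 2) \<circ> \<phi>"
  proof (rule lifts_eqI[OF lifts_comp[OF lifts_mixed_form lift\<phi>] lifts_comp[OF lift\<phi> lift_target]])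
    fix u v
    have "2 * (1 * qform (- 1 / 2) 0 1 u v + - c * qform 0 1 0 u v) = - ((u + c * v)\<^sup>2)"
      "2 * (1 * qform (- 1 / 2) 0 1 u v + c * qform 0 1 0 u v) = - ((u - c * v)\<^sup>2)"
      using c2 by (simp_all add: qform_def) algebra+
    moreover have "qform 1 0 0 (1 * u + - c * v) (1 * u + c * v) = (u - c * v)\<^sup>2"
      "qform 0 0 1 (1 * u + - c * v) (1 * u + c * v) = (u + c * v)\<^sup>2"
      by (simp_all add: qform_def)
    ultimately show "(1 * qform (- 1 / 2) 0 1 u v + - c * qform 0 1 0 u v) *
          qform 1 0 0 (1 * u + - c * v) (1 * u + c * v)
        = qform 0 0 1 (1 * u + - c * v) (1 * u + c * v) *
          (1 * qform (- 1 / 2) 0 1 u v + c * qform 0 1 0 u v)"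
      by algebra
  qed simp
  moreover have "moebius_transformation \<phi>" by (rule moebius_of_lift[OF det lift\<phi>])
  ultimately show ?thesis unfolding conjugate_maps_def by blast
qed

text \<open>
  The multipliers of the three fixed points satisfy
  \<open>1 / (1 - \<nu>) + 1 / (1 - \<nu>\<^sub>1) + 1 / (1 - \<nu>\<^sub>2) = 1\<close> as soon as none of them is \<open>1\<close>. If none of them is \<open>0\<close> or \<open>- 1\<close> either,
  integrality forces all three to be \<open>- 2\<close>, which determines the map up to conjugacy.
\<close>
lemma exceptional_if_integral:
  assumes quad: "quadratic g" and int: "integral_periods g"
  shows "exceptional g"
proof (rule ccontr)
  assume not: "\<not> exceptional g"
  have "\<nu> \<notin> {0, 1, - 1}" if "quadratic h" "integral_periods h" "\<not> exceptional h"
      "h x = x" "has_sphere_deriv h x \<nu>" for h x \<nu>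
    using that exceptional_if_superattracting_fixed no_parabolic_fixed exceptional_if_fixed_minus_1
    by blast
  note ne = this
  have one_minus: "1 - n \<notin> {0, 1, 2}" if "(of_int n :: complex) \<notin> {0, 1, - 1}" for n :: int
    using that by auto
  obtain x where x: "g x = x" using quadratic_fixed_point[OF quad] .
  obtain \<nu> where \<nu>: "has_sphere_deriv g x \<nu>"
    using sphere_differentiable_if_quadratic[OF quad] unfolding sphere_differentiable_def by blast
  obtain n where n: "\<nu> = of_int n" using integral_fixed_point[OF int x \<nu>] by (rule Ints_cases)
  have \<nu>ne: "\<nu> \<notin> {0, 1, - 1}" by (rule ne[OF quad int not x \<nu>])
  define a where "a = 1 / \<nu>"
  have a: "a * \<nu> = 1" "a \<noteq> 0" "a - 1 \<noteq> 0" using \<nu>ne by (auto simp: a_def)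
  obtain b where conj: "conjugate_maps g (mixed_form a b)"
    using normal_form(2)[OF quad x \<nu>] \<nu>ne unfolding a_def by auto
  let ?h = "mixed_form a b"
  have inth: "integral_periods ?h"
    using integral_periods_conjugate[OF conj int] sphere_differentiable_if_quadratic[OF quad] .
  have quadh: "quadratic ?h" using quadratic_mixed_form a(2) .
  have noth: "\<not> exceptional ?h" using exceptional_conjugate[OF conj] not by blast
  obtain r1 r2 where r: "r1 + r2 = - b" "r1 * r2 = a - 1" by (rule complex_quadratic_roots)
  have eq: "r1\<^sup>2 + b * r1 + (a - 1) = 0" "r2\<^sup>2 + b * r2 + (a - 1) = 0"
    using r by algebra+
  have r0: "r1 \<noteq> 0" "r2 \<noteq> 0" using r a by auto
  note F1 = mixed_form_fixed_point[OF a(2) r0(1) eq(1)] and F2 = mixed_form_fixed_point[OF a(2) r0(2) eq(2)]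
  obtain n1 where n1: "a - r1\<^sup>2 = of_int n1"
    using integral_fixed_point[OF inth F1] by (rule Ints_cases)
  obtain n2 where n2: "a - r2\<^sup>2 = of_int n2"
    using integral_fixed_point[OF inth F2] by (rule Ints_cases)
  define A B C where "A = 1 - n" and "B = 1 - n1" and "C = 1 - n2"
  have ABC: "of_int A = 1 - \<nu>" "of_int B = 1 - (a - r1\<^sup>2)" "of_int C = 1 - (a - r2\<^sup>2)"
    by (simp_all add: A_def B_def C_def n n1 n2)
  \<comment> \<open>Cleared of denominators, the holomorphic fixed point formula \<open>1 / A + 1 / B + 1 / C = 1\<close>.\<close>
  have "(1 - \<nu>) * (1 - (a - r1\<^sup>2)) + (1 - \<nu>) * (1 - (a - r2\<^sup>2)) + (1 - (a - r1\<^sup>2)) * (1 - (a - r2\<^sup>2))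
      = (1 - \<nu>) * (1 - (a - r1\<^sup>2)) * (1 - (a - r2\<^sup>2))"
    using r(2) a(1) by algebra
  then have "of_int (A * B + A * C + B * C) = (of_int (A * B * C) :: complex)"
    unfolding of_int_add of_int_mult ABC .
  then have "A * B + A * C + B * C = A * B * C" by (simp only: of_int_eq_iff)
  moreover have "A \<notin> {0, 1, 2}" "B \<notin> {0, 1, 2}" "C \<notin> {0, 1, 2}"
    unfolding A_def B_def C_def
    using one_minus \<nu>ne n ne[OF quadh inth noth F1] ne[OF quadh inth noth F2] n1 n2 by metis+
  ultimately have "A = 3 \<and> B = 3 \<and> C = 3" by (rule unit_fraction_triple)
  moreover have "\<nu> = 1 - of_int A" "r1\<^sup>2 = a + (of_int B - 1)" "r2\<^sup>2 = a + (of_int C - 1)"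
    unfolding ABC by simp_all
  ultimately have e: "\<nu> = - 2" "r1\<^sup>2 = a + 2" "r2\<^sup>2 = a + 2" by simp_all
  have a': "a = - 1 / 2" using e(1) by (simp add: a_def)
  have "b\<^sup>2 = 4 * a + 2" using e r by algebra
  then have "b = 0" by (simp add: a')
  then have "exceptional ?h" using mixed_form_conjugate_inverse_square a'
    unfolding exceptional_def by simp
  then show False using noth by blast
qed

lemma chebyshev_poly_2: "chebyshev_poly 2 = [:- 2, 0, 1:]"
  unfolding chebyshev_poly_def
  by (rule the1_equality[OF chebyshev_poly_ex1])
    (auto simp: power2_eq_square algebra_simps)

lemma rat_fun_monic_quadratic: "rat_fun [:c, 0, 1:] 1 = quad_poly c"
proof
  fix x
  show "rat_fun [:c, 0, 1:] 1 x = quad_poly c x"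
    by (cases x) (simp_all add: rat_fun_def quad_poly_def power2_eq_square algebra_simps)
qed

theorem corollary10:
  fixes f :: "riemann_sphere \<Rightarrow> riemann_sphere"
  assumes "rational_map_of_degree 2 f"
    and "only_integer_multipliers f"
  shows "power_map f \<or> chebyshev_map f"
proof -
  have quad: "quadratic f" using quadratic_if_degree_2[OF assms(1)] .
  have "integral_periods f"
    using integral_periods_if_only_integer_multipliers[OF assms(2)] sphere_differentiable_if_quadratic[OF quad] .
  with quad have "exceptional f" by (rule exceptional_if_integral)
  moreover have "quad_poly 0 = rat_fun (monom 1 2) 1"
    unfolding rat_fun_monic_quadratic[symmetric] by (simp add: numeral_2_eq_2 monom_Suc monom_0)
  moreover have "quad_poly (- 2) = rat_fun (chebyshev_poly 2) 1"
    by (simp add: chebyshev_poly_2 rat_fun_monic_quadratic)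
  ultimately show ?thesis
    using assms(1) unfolding exceptional_def power_map_def chebyshev_map_def by auto
qed

end
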